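(* Let $\ell\ge4$ be even and $n=2^\ell$. Consider the basis $\mathcal{B}$ of $\mathbb{F}_{2^\ell}$ over $\mathbb{F}_2$ and the linear repair scheme $\{g_j(x)\}_{j=1}^\ell$ for node $0$ of ${\rm RS}(\mathbb{F}_{2^\ell},2^\ell-3)$ given by the construction described in the context. The I/O cost of this scheme with respect to $\mathcal{B}$ is $$\gamma_{I/O}=(n-1)\ell-2^\ell,$$ which is optimal, i.e. it is the minimum possible I/O cost of a linear repair scheme over $\mathbb{F}_2$ for ${\rm RS}(\mathbb{F}_{2^\ell},2^\ell-3)$. Moreover, the repair bandwidth $b$ of this scheme satisfies $$(n-1)(\ell-1)-2^{\ell-1}+2^{\ell-4}\ \leq\ b\ \leq\ (n-1)\ell-2^\ell.$$
   Context: General definitions. Let $B=\mathbb{F}_2$, $F=\mathbb{F}_{2^\ell}$, ${\rm Tr}$ the trace from $F$ to $B$. For $\mathcal{A}=\{\alpha_1,\dots,\alpha_n\}\subseteq F$ and $1\le k<n$, ${\rm RS}(\mathcal{A},k)=\{(f(\alpha_1),\dots,f(\alpha_n)): f\in F[x],\ \deg f\le k-1\}$; coordinate $i$ is called node $i$, and "node $0$" means the coordinate with evaluation point $0$. Here $\mathcal{A}=F$ and ${\rm RS}(F,k)^\perp={\rm RS}(F,n-k)$. A linear repair scheme (over $B$) for node $i^*$ of ${\rm RS}(\mathcal{A},k)$ is a list of $\ell$ polynomials $g_1,\dots,g_\ell\in F[x]$ of degree less than $n-k$ such that $g_1(\alpha_{i^*}),\dots,g_\ell(\alpha_{i^*})$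 are linearly independent over $B$. Given a basis $\mathcal{B}=\{\beta^{(1)},\dots,\beta^{(\ell)}\}$ of $F$ over $B$, let $W_i$ be the $\ell\times\ell$ matrix over $B$ whose $(j,s)$ entry is ${\rm Tr}(g_j(\alpha_i)\beta^{(s)})$. The I/O cost with respect to $\mathcal{B}$ is $\gamma_{I/O}=\sum_{i=1}^n{\rm nz}(W_i)-\ell=\sum_{i\ne i^*}{\rm nz}(W_i)$, where ${\rm nz}(W)$ is the number of nonzero columns of $W$; the repair bandwidth is $b=\sum_{i=1}^n{\rm rank}(W_i)-\ell=\sum_{i\ne i^*}{\rm rank}(W_i)$. The minimum for optimality is over all linear repair schemes (for any node) and all bases of $F$ over $B$. Construction. Let $\zeta\in\mathbb{F}_4\subseteq\mathbb{F}_{2^\ell}$ be a root of $x^2+x+1$, and let $\theta$ be a primitive element of $\mathbb{F}_{2^\ell}$, chosen so that the four elements $$\beta^{(1)}=(\theta^2+(\zeta+1)\theta+1)^2,\quad \beta^{(2)}=(\zeta\theta)^2,\quad \beta^{(3)}=1,\quad \beta^{(4)}=(\theta+1)^2$$ are linearly independent over $\mathbb{F}_2$ (such $\theta$ always exists; for $\ell\ge6$ the independence is automatic, and for $\ell=4$ one may take $\theta$ a root of $x^2+x+\zeta$). Extend them to a basis $\mathcal{B}=\{\beta^{(1)},\dots,\beta^{(\ell)}\}$ of $\mathbb{F}_{2^\ell}$ over $\mathbb{F}_2$, and let $\{\gamma^{(1)},\dots,\gamma^{(\ell)}\}$ be the dual basis, i.e. ${\rm Tr}(\beta^{(i)}\gamma^{(j)})=1$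 if $i=j$ and $0$ otherwise. Define $$g_j(x)=\lambda_jx^2+\eta_jx+\omega_j\ \ (1\le j\le4),\qquad g_j(x)=\gamma^{(j)}\ \ (5\le j\le\ell),$$ where $\eta_1=1,\ \eta_2=\zeta,\ \eta_3=\zeta\theta,\ \eta_4=\theta$; $\omega_1=\gamma^{(3)},\ \omega_2=\gamma^{(2)}+\gamma^{(4)},\ \omega_3=\gamma^{(1)}+\gamma^{(3)},\ \omega_4=\gamma^{(4)}$; $\lambda_j=\eta_j^2\beta^{(1)}$ for $j\in\{1,2\}$ and $\lambda_j=\eta_j^2\beta^{(2)}$ for $j\in\{3,4\}$. *)

theory Defs
  imports
    "HOL-Library.Cardinality"
    "HOL-Library.Z2"
    "HOL-Computational_Algebra.Polynomial"
    "HOL-Computational_Algebra.Primes"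
    "Jordan_Normal_Form.DL_Rank"
begin

(* B is the type bit, F is a finite field 'a with 2 ^ l elements.  All families of length l
   (schemes, bases) are functions on nat of which only the values at 1, ..., l matter. *)

definition bscale :: "bit \<Rightarrow> 'a::field \<Rightarrow> 'a"
  where "bscale b x = of_bit b * x"

lemma vector_space_bscale:
  assumes "CHAR('a::field) = 2"
  shows "Vector_Spaces.vector_space (bscale :: bit \<Rightarrow> 'a \<Rightarrow> 'a)"
proof
  have two: "(1::'a) + 1 = 0"
    using of_nat_CHAR[where 'a = 'a] unfolding assms by simp
  fix a b :: bit and x y :: 'a
  show "bscale a (x + y) = bscale a x + bscale a y"
    by (simp add: bscale_def algebra_simps)
  have "x + x = (1 + 1) * x"
    by (simp only: distrib_right mult_1_left)
  then have "x + x = 0"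
    by (simp only: two mult_zero_left)
  then show "bscale (a + b) x = bscale a x + bscale b x"
    by (cases a; cases b) (simp_all add: bscale_def)
  show "bscale a (bscale b x) = bscale (a * b) x"
    by (cases a; cases b) (simp_all add: bscale_def)
  show "bscale 1 x = x"
    by (simp add: bscale_def)
qed

definition B_indep :: "nat set \<Rightarrow> (nat \<Rightarrow> 'a::field) \<Rightarrow> bool"
  where "B_indep I v \<longleftrightarrow> inj_on v I \<and> \<not> Modules.module.dependent bscale (v ` I)"

definition B_basis :: "nat \<Rightarrow> (nat \<Rightarrow> 'a::field) \<Rightarrow> bool"
  where "B_basis l \<beta> \<longleftrightarrow>
    B_indep {1..l} \<beta> \<and> Modules.module.span bscale (\<beta> ` {1..l}) = UNIV"

(* The trace is the sum of the conjugates x ^ (2 ^ i), i < l.  This sum is 0 or 1 when F has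
   2 ^ l elements, see of_bit_Tr, and is read here as an element of B. *)
definition Tr :: "nat \<Rightarrow> 'a::field \<Rightarrow> bit"
  where "Tr l x = of_bool ((\<Sum>i<l. x ^ (2 ^ i)) \<noteq> 0)"

lemma of_bit_Tr:
  fixes x :: "'a::finite_field"
  assumes char: "CHAR('a) = 2" and card: "CARD('a) = 2 ^ l"
  shows "of_bit (Tr l x) = (\<Sum>i<l. x ^ (2 ^ i))"
proof -
  let ?S = "\<Sum>i<l. x ^ (2 ^ i)"
  have "?S ^ 2 = (\<Sum>i<l. (x ^ (2 ^ i)) ^ 2)"
    by (rule freshmans_dream_sum) (simp_all add: char)
  also have "\<dots> = (\<Sum>i<l. x ^ (2 ^ Suc i))"
    by (simp add: mult.commute flip: power_mult)
  also have "\<dots> = (\<Sum>i<Suc l. x ^ (2 ^ i)) - x"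
    by (subst sum.lessThan_Suc_shift) simp
  also have "\<dots> = ?S"
    using finite_field_power_card_eq_same[of x] card by simp
  finally have "?S * (?S - 1) = 0"
    by (simp add: power2_eq_square algebra_simps)
  then have "?S = 0 \<or> ?S = 1"
    by simp
  then show ?thesis
    by (auto simp: Tr_def)
qed

definition primitive_element :: "'a::field \<Rightarrow> bool"
  where "primitive_element \<theta> \<longleftrightarrow> range (\<lambda>i::nat. \<theta> ^ i) = UNIV - {0}"

(* A linear repair scheme over B for the node of RS(A, k) whose evaluation point is a.
   Nodes are identified with their evaluation points. *)
definition linear_repair_scheme ::
    "nat \<Rightarrow> 'a::field set \<Rightarrow> nat \<Rightarrow> 'a \<Rightarrow> (nat \<Rightarrow> 'a poly) \<Rightarrow> bool"
  where "linear_repair_scheme l A k a g \<longleftrightarrow>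
    1 \<le> k \<and> k < card A \<and> a \<in> A \<and>
    (\<forall>j\<in>{1..l}. degree (g j) < card A - k) \<and>
    B_indep {1..l} (\<lambda>j. poly (g j) a)"

(* mat is indexed from 0, hence the successors. *)
definition W :: "nat \<Rightarrow> (nat \<Rightarrow> 'a::field) \<Rightarrow> (nat \<Rightarrow> 'a poly) \<Rightarrow> 'a \<Rightarrow> bit mat"
  where "W l \<beta> g \<alpha> = mat l l (\<lambda>(j, s). Tr l (poly (g (Suc j)) \<alpha> * \<beta> (Suc s)))"

definition nz :: "'b::zero mat \<Rightarrow> nat"
  where "nz M = card {s. s < dim_col M \<and> col M s \<noteq> 0\<^sub>v (dim_row M)}"

definition io_cost ::
    "nat \<Rightarrow> 'a::field set \<Rightarrow> 'a \<Rightarrow> (nat \<Rightarrow> 'a) \<Rightarrow> (nat \<Rightarrow> 'a poly) \<Rightarrow> nat"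
  where "io_cost l A a \<beta> g = (\<Sum>\<alpha>\<in>A - {a}. nz (W l \<beta> g \<alpha>))"

definition repair_bandwidth ::
    "nat \<Rightarrow> 'a::field set \<Rightarrow> 'a \<Rightarrow> (nat \<Rightarrow> 'a) \<Rightarrow> (nat \<Rightarrow> 'a poly) \<Rightarrow> nat"
  where "repair_bandwidth l A a \<beta> g = (\<Sum>\<alpha>\<in>A - {a}. vec_space.rank l (W l \<beta> g \<alpha>))"

end

theory Submission
  imports Defs "HOL-Library.Product_Plus"
begin

text \<open>
  For \<open>b\<close> in the field \<open>F\<close> let \<open>N b\<close> be the number of nodes \<open>\<alpha>\<close> with \<open>Tr (g\<^sub>j(\<alpha>) b) = 0\<close> for all \<open>j\<close>; the I/O cost
  with respect to a basis \<open>\<beta>\<close> is \<open>(n - 1) l\<close> minus the sum of the \<open>N \<beta>\<^sub>s\<close>.  Write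
  \<open>h\<^sub>j(x) = lam\<^sub>j (x - a)\<^sup>2 + eta\<^sub>j (x - a) + \<omega>\<^sub>j\<close>.  The \<open>\<omega>\<^sub>j\<close> form a basis, so \<open>lam\<close> and \<open>eta\<close> extend to additive
  maps on \<open>F\<close>.  As \<open>Tr (b eta x) = Tr (b\<^sup>2 eta\<^sup>2 x\<^sup>2)\<close>, duality gives \<open>N b \<le> |K b|\<close> for
  \<open>K b = {\<omega>. lam \<omega> = b (eta \<omega>)\<^sup>2}\<close>, and \<open>N b \<noteq> 0\<close> forces \<open>Tr (b \<omega>) = 0\<close> on \<open>K b\<close>.  Any two of the \<open>K b\<close> meet
  in the common zeros of \<open>lam\<close> and \<open>eta\<close>, and this bounds the sum of the \<open>|K \<beta>\<^sub>s|\<close> with \<open>N \<beta>\<^sub>s \<noteq> 0\<close> by \<open>n\<close>.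

  For the given scheme exactly four columns can vanish, each at \<open>n/4\<close> nodes.  The rank of
  \<open>W\<^sub>\<alpha>\<close> falls below the number of nonzero columns by at most one, and only if three or four of
  the first four columns sum to zero, that is, if \<open>\<alpha>\<close> is counted by \<open>N\<close> of a sum of three or four of
  \<open>\<beta>\<^sub>1, \<dots>, \<beta>\<^sub>4\<close>.  Each such \<open>N\<close> is at most \<open>n/16\<close>, unless the sum of all four is
  \<open>((s\<^sub>1 + \<theta> s\<^sub>3)/(\<theta> + 1))\<^sup>2\<close>, where \<open>s\<^sub>1\<^sup>2 = \<beta>\<^sub>1\<close> and \<open>s\<^sub>3\<^sup>2 = \<beta>\<^sub>2\<close>; then \<open>\<theta>\<^sup>2 = \<zeta>\<theta> + \<zeta>\<close>, hence \<open>l = 4\<close>, and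
  at most 6 nodes are exceptional.
\<close>

section \<open>Counting and rank\<close>

text \<open>A set of indices stands for a vector of coefficients 0 and 1, and symmetric difference
  adds such vectors: whatever lies over the intersection occurs twice and cancels.\<close>

lemma sum_symdiff:
  fixes f :: "'b \<Rightarrow> 'a::ab_group_add"
  assumes "\<And>x::'a. x + x = 0" "finite S" "finite T"
  shows "sum f (sym_diff S T) = sum f S + sum f T"
proof -
  have "sum f S = sum f (S - T) + sum f (S \<inter> T)"
    using sum.Int_Diff[OF assms(2), of f T] by (simp add: add.commute)
  moreover have "sum f T = sum f (T - S) + sum f (S \<inter> T)"
    using sum.Int_Diff[OF assms(3), of f S] by (simp add: add.commute Int_commute)
  moreover have "sum f (sym_diff S T) = sum f (S - T) + sum f (T - S)"
    using assms by (intro sum.union_disjoint) auto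
  ultimately have "sum f S + sum f T = sum f (sym_diff S T) + (sum f (S \<inter> T) + sum f (S \<inter> T))"
    by (simp add: algebra_simps)
  then show ?thesis using assms(1) by simp
qed

text \<open>Every nonempty fibre is a translate of the kernel.\<close>

lemma card_range_mult_card_kernel:
  fixes f :: "'a::{finite, ab_group_add} \<Rightarrow> 'b::ab_group_add"
  assumes add: "\<And>x y. f (x + y) = f x + f y"
  shows "card (range f) * card {x. f x = 0} = CARD('a)"
proof -
  have "card {x. f x = f y} = card {x. f x = 0}" for y
    by (rule bij_betw_same_card[where f = "\<lambda>x. x - y"], rule bij_betw_byWitness[where f' = "\<lambda>x. x + y"])
      (use add in \<open>auto simp: image_def\<close>, metis add add_diff_cancel_right' diff_add_cancel diff_self)
  then have "card {x. f x = z} = card {x. f x = 0}" if "z \<in> range f" for z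
    using that by auto
  moreover have "CARD('a) = (\<Sum>z\<in>range f. card {x. f x = z})"
    using sum.image_gen[of "UNIV :: 'a set" "\<lambda>_. 1 :: nat" f] by simp
  ultimately show ?thesis by simp
qed

text \<open>The exponents will be dimensions of subspaces of a \<open>d\<close>-dimensional space
  that pairwise meet in 0. The largest one, \<open>u s\<close>, confines the others to
  \<open>w = min (u s) (d - u s)\<close>, so the sum is at most
  \<open>2^(u s) + (d - 1) 2^w\<close>.\<close>

lemma sum_two_power_le:
  fixes u :: "'i \<Rightarrow> nat"
  assumes "finite S" and card: "card S \<le> d"
    and less: "\<And>s. s \<in> S \<Longrightarrow> u s < d"
    and pair: "\<And>s t. s \<in> S \<Longrightarrow> t \<in> S \<Longrightarrow> s \<noteq> t \<Longrightarrow> u s + u t \<le> d"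
  shows "(\<Sum>s\<in>S. 2 ^ u s) \<le> (2::nat) ^ d"
proof (cases "S = {}")
  case False
  have "Max (u ` S) \<in> u ` S"
    using False \<open>finite S\<close> by simp
  then obtain s where s: "s \<in> S" "u s = Max (u ` S)" by auto
  have max: "u t \<le> u s" if "t \<in> S" for t
    using that s \<open>finite S\<close> by simp
  define w where "w = min (u s) (d - u s)"
  have "u t \<le> w" if "t \<in> S - {s}" for t
    using max[of t] pair[of s t] s(1) that by (auto simp: w_def)
  then have "(\<Sum>t\<in>S - {s}. 2 ^ u t) \<le> (\<Sum>t\<in>S - {s}. (2::nat) ^ w)"
    by (intro sum_mono power_increasing) auto
  also have "\<dots> \<le> (d - 1) * 2 ^ w"
    using card s(1) \<open>finite S\<close> by simp
  finally have le: "(\<Sum>t\<in>S. 2 ^ u t) \<le> (2::nat) ^ u s + (d - 1) * 2 ^ w"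
    using s(1) \<open>finite S\<close> by (simp add: sum.remove)
  have exp: "2 * k \<le> (2::nat) ^ k" for k
  proof (induction k)
    case (Suc k)
    then show ?case by (cases k) auto
  qed simp
  have us: "u s < d" by (rule less[OF s(1)])
  show ?thesis
  \<comment> \<open>If \<open>u s\<close> is below \<open>d/2\<close>, then \<open>w = u s\<close>,
    and \<open>d < 2 k \<le> 2^k\<close> bounds \<open>d\<close> terms of size
    \<open>2^(u s)\<close>.\<close>
  proof (cases "2 * u s < d")
    case True
    define k where "k = d - u s"
    have k: "d = u s + k" "u s < k" using True us by (auto simp: k_def)
    have "2 ^ u s + (d - 1) * 2 ^ w = d * (2::nat) ^ u s"
      using True us by (cases d) (auto simp: w_def)
    also have "\<dots> \<le> 2 ^ k * 2 ^ u s"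
      using exp[of k] k by (intro mult_right_mono) auto
    also have "\<dots> = 2 ^ d" using k by (simp add: power_add)
    finally show ?thesis using le by simp
  next
    case False
    define k where "k = d - u s"
    define e where "e = d - 2 * k"
    have d: "u s = k + e" "d = 2 * k + e" "1 \<le> k" and w: "w = k"
      using False us by (auto simp: k_def e_def w_def)
    \<comment> \<open>The target is \<open>d - 1 \<le> 2^e (2^k - 1)\<close>, since
      \<open>2^(k+e) + 2^e (2^k - 1) 2^k\<close> is exactly \<open>2^d\<close>.\<close>
    have "2 * k - 1 + e \<le> 2 ^ k - 1 + e"
      using exp[of k] d(3) by simp
    also have "\<dots> \<le> 2 ^ k - 1 + e * (2 ^ k - 1)"
    proof -
      have "1 \<le> (2::nat) ^ k - 1" using exp[of k] d(3) by simp
      then have "e * 1 \<le> e * (2 ^ k - 1)" by (rule mult_le_mono2)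
      then show ?thesis by (simp only: mult_1_right add_left_mono)
    qed
    also have "\<dots> = (e + 1) * ((2::nat) ^ k - 1)"
      by simp
    also have "\<dots> \<le> 2 ^ e * (2 ^ k - 1)"
    proof (rule mult_right_mono)
      show "e + 1 \<le> 2 ^ e" by (induction e) auto
    qed simp
    finally have "d - 1 \<le> 2 ^ e * (2 ^ k - 1)"
      using d by simp
    then have "2 ^ u s + (d - 1) * 2 ^ w \<le> 2 ^ (k + e) + 2 ^ e * (2 ^ k - 1) * (2::nat) ^ k"
      unfolding w d(1) by (intro add_left_mono mult_right_mono) auto
    also have "\<dots> = 2 ^ (k + e) + 2 ^ e * (2 ^ k * 2 ^ k - (2::nat) ^ k)"
      by (simp add: algebra_simps)
    also have "\<dots> = 2 ^ d"
      using d by (simp add: power_add algebra_simps power_mult power2_eq_square)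
    finally show ?thesis using le by simp
  qed
qed simp

text \<open>Two pairs in \<open>K \<times> L\<close> with the same sum differ by an element of
  \<open>K \<inter> L\<close>. With one pair \<open>r z\<close> chosen for each sum
  \<open>z\<close>, a pair is determined by its sum and its difference from the chosen one.\<close>

lemma card_mult_card_le:
  fixes K L :: "'b::{finite, ab_group_add} set"
  assumes K: "\<And>x y. x \<in> K \<Longrightarrow> y \<in> K \<Longrightarrow> x - y \<in> K"
    and L: "\<And>x y. x \<in> L \<Longrightarrow> y \<in> L \<Longrightarrow> x - y \<in> L"
  shows "card K * card L \<le> CARD('b) * card (K \<inter> L)"
proof -
  define r where "r z = (SOME p. p \<in> K \<times> L \<and> fst p + snd p = z)" for z
  define f where "f p = (fst p + snd p, fst p - fst (r (fst p + snd p)))" for p :: "'b \<times> 'b"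
  have r: "r (fst p + snd p) \<in> K \<times> L \<and> fst (r (fst p + snd p)) + snd (r (fst p + snd p)) = fst p + snd p"
    if "p \<in> K \<times> L" for p
    unfolding r_def by (rule someI[of _ p]) (use that in auto)
  have "inj_on f (K \<times> L)"
    by (rule inj_onI) (auto simp: f_def)
  moreover have "f ` (K \<times> L) \<subseteq> UNIV \<times> (K \<inter> L)"
  proof (intro image_subsetI)
    fix p assume p: "p \<in> K \<times> L"
    define q where "q = r (fst p + snd p)"
    have q: "q \<in> K \<times> L" "fst q + snd q = fst p + snd p"
      using r[OF p] by (simp_all add: q_def)
    then have "fst p - fst q = snd q - snd p"
      by (simp add: algebra_simps)
    with p q have "fst p - fst q \<in> K \<inter> L"
      using K[of "fst p" "fst q"] L[of "snd q" "snd p"] by auto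
    then show "f p \<in> UNIV \<times> (K \<inter> L)"
      by (simp add: f_def q_def)
  qed
  ultimately have "card (K \<times> L) \<le> card ((UNIV :: 'b set) \<times> (K \<inter> L))"
    by (intro card_inj_on_le) auto
  then show ?thesis by (simp add: card_cartesian_product)
qed

text \<open>Coefficients in \<open>bit\<close> are 0 or 1, so a dependence among columns is a
  nonempty set of columns with zero sum. Two equal columns form such a set, which gives injectivity
  of \<open>col M\<close> on \<open>S\<close>.\<close>

lemma card_le_rank_bit:
  fixes M :: "bit mat"
  assumes M: "M \<in> carrier_mat m c" and S: "S \<subseteq> {..<c}"
    and indep: "\<And>T. T \<subseteq> S \<Longrightarrow> T \<noteq> {} \<Longrightarrow> \<exists>i<m. (\<Sum>s\<in>T. M $$ (i, s)) \<noteq> 0"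
  shows "card S \<le> vec_space.rank m M"
proof -
  interpret vec_space "TYPE(bit)" m .
  have fin: "finite S" using S finite_subset by blast
  have carrier: "col M ` S \<subseteq> carrier_vec m"
    using M by auto
  have entry: "col M s $ i = M $$ (i, s)" if "s \<in> S" "i < m" for s i
    using that M S by auto
  have inj: "inj_on (col M) S"
  proof (rule inj_onI, rule ccontr)
    fix s t assume st: "s \<in> S" "t \<in> S" "col M s = col M t" "s \<noteq> t"
    then obtain i where "i < m" "(\<Sum>s\<in>{s, t}. M $$ (i, s)) \<noteq> 0"
      using indep[of "{s, t}"] by auto
    moreover have "M $$ (i, s) = M $$ (i, t)"
      using st entry \<open>i < m\<close> by metis
    ultimately show False using st(4) by simp
  qed
  have trivial: "\<forall>v\<in>col M ` S. a v = 0" if a: "lincomb a (col M ` S) = 0\<^sub>v m" for a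
  proof -
    define T where "T = {s\<in>S. a (col M s) \<noteq> 0}"
    have "(\<Sum>s\<in>T. M $$ (i, s)) = 0" if "i < m" for i
    proof -
      have "(\<Sum>s\<in>T. M $$ (i, s)) = (\<Sum>s\<in>S. if a (col M s) \<noteq> 0 then M $$ (i, s) else 0)"
        unfolding T_def by (rule sum.inter_filter[OF fin])
      also have "\<dots> = (\<Sum>s\<in>S. a (col M s) * col M s $ i)"
        using entry that by (intro sum.cong) (auto simp: mult_eq_0_iff)
      also have "\<dots> = (\<Sum>v\<in>col M ` S. a v * v $ i)"
        using inj by (simp add: sum.reindex)
      also have "\<dots> = lincomb a (col M ` S) $ i"
        using lincomb_index[OF that carrier] by simp
      also have "\<dots> = 0" using a that by simp
      finally show ?thesis .
    qed
    moreover have "T \<subseteq> S" by (auto simp: T_def)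
    ultimately have "T = {}" using indep by blast
    then show ?thesis by (auto simp: T_def)
  qed
  have "lin_indpt (col M ` S)"
    by (rule finite_lin_indpt2) (use fin carrier trivial in auto)
  moreover have "col M ` S \<subseteq> set (cols M)"
    using S M by (auto simp: cols_def)
  ultimately have "card (col M ` S) \<le> rank M"
    using M by (intro rank_ge_card_indpt)
  then show ?thesis using inj by (simp add: card_image)
qed

text \<open>The rank is the size of a maximal independent set of columns, and such a set avoids the
  zero vector.\<close>

lemma rank_le_nz:
  fixes M :: "'b::field mat"
  assumes M: "M \<in> carrier_mat m c"
  shows "vec_space.rank m M \<le> nz M"
proof -
  interpret vec_space "TYPE('b)" m .
  obtain U where U: "maximal U (\<lambda>T. T \<subseteq> set (cols M) \<and> lin_indpt T)"
    using maximal_exists_superset[of "set (cols M)" "\<lambda>T. T \<subseteq> set (cols M) \<and> lin_indpt T" "{}"]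
      finite_lin_indpt2[of "{}"] by auto
  then have U': "U \<subseteq> set (cols M)" "lin_indpt U" by (auto simp: maximal_def)
  have "(UNIV :: 'b set) \<noteq> {0}" by (metis UNIV_I singletonD zero_neq_one)
  then have "0\<^sub>v m \<notin> U"
    using U'(2) zero_lin_dep[of U] by auto
  then have "U \<subseteq> col M ` {s. s < dim_col M \<and> col M s \<noteq> 0\<^sub>v (dim_row M)}"
    using U'(1) M by (fastforce simp: cols_def)
  then have "card U \<le> nz M"
    unfolding nz_def by (rule surj_card_le[rotated]) simp
  then show ?thesis using rank_card_indpt[OF M U] by simp
qed

section \<open>Trace systems over a field of characteristic two\<close>

locale binary_field =
  fixes l :: nat and F :: "'a::finite_field itself"
  assumes card_field: "CARD('a) = 2 ^ l"
begin

text \<open>Translation by 1 permutes the field, so adding \<open>2^l\<close> times 1 does not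
  change the sum of all elements; hence the characteristic divides \<open>2^l\<close>.\<close>

lemma CHAR_eq_2: "CHAR('a) = 2"
proof -
  have "(\<Sum>x\<in>UNIV. x) = (\<Sum>x\<in>UNIV. x + (1::'a))"
    by (rule sum.reindex_bij_witness[of _ "\<lambda>x. x + 1" "\<lambda>x. x - 1"]) simp_all
  then have "of_nat (2 ^ l) = (0::'a)"
    by (simp add: sum.distrib card_field)
  then have "CHAR('a) dvd 2 ^ l"
    by (simp only: of_nat_eq_0_iff_char_dvd)
  then show ?thesis
    using prime_CHAR_semidom[OF finite_imp_CHAR_pos[OF finite[of "UNIV :: 'a set"]]]
    by (metis prime_dvd_power primes_dvd_imp_eq two_is_prime_nat)
qed

lemma add_self [simp]: "x + x = (0::'a)"
proof -
  have "(1::'a) + 1 = 0"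
    using of_nat_CHAR[where 'a = 'a] unfolding CHAR_eq_2 by simp
  then show ?thesis
    by (metis distrib_left mult.right_neutral mult_zero_right)
qed

lemma two_eq_0 [simp]: "(2::'a) = 0"
  by (metis add_self one_add_one)

lemma minus_eq_plus [simp]: "x - y = x + (y::'a)" and uminus_eq [simp]: "- y = (y::'a)"
proof -
  show "- y = y" by (metis add_self add.inverse_unique)
  then show "x - y = x + y" by (metis diff_conv_add_uminus)
qed

lemma add_eq_0 [simp]: "x + y = 0 \<longleftrightarrow> x = (y::'a)"
  by (metis minus_eq_plus right_minus_eq)

lemma square_add: "(x + y)\<^sup>2 = x\<^sup>2 + (y::'a)\<^sup>2"
proof -
  have "(x + y)\<^sup>2 = x\<^sup>2 + y\<^sup>2 + (x * y + x * y)"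
    by (simp add: power2_eq_square algebra_simps del: add_self)
  then show ?thesis by simp
qed

lemma square_inj: "x\<^sup>2 = (y::'a)\<^sup>2 \<longleftrightarrow> x = y"
  using square_add[of x y] by (metis add_eq_0 power2_eq_iff uminus_eq)

lemma of_bit_add: "(of_bit (a + b) :: 'a) = of_bit a + of_bit b"
  by (cases a; cases b) simp_all

lemma of_bit_inj: "(of_bit a :: 'a) = of_bit b \<longleftrightarrow> a = b"
  by (cases a; cases b) simp_all

lemma Tr_add [simp]: "Tr l (x + y) = Tr l x + Tr l (y::'a)"
proof -
  have "(x + y) ^ 2 ^ i = x ^ 2 ^ i + y ^ 2 ^ i" for i
    by (rule freshmans_dream') (simp_all add: CHAR_eq_2)
  then have "(of_bit (Tr l (x + y)) :: 'a) = of_bit (Tr l x + Tr l y)"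
    unfolding of_bit_add of_bit_Tr[OF CHAR_eq_2 card_field] by (simp only: sum.distrib)
  then show ?thesis by (simp only: of_bit_inj)
qed

lemma Tr_0 [simp]: "Tr l (0::'a) = 0"
  by (simp add: Tr_def)

lemma Tr_sum: "Tr l (sum f A) = (\<Sum>i\<in>A. Tr l (f i :: 'a))"
  by (induction A rule: infinite_finite_induct) simp_all

lemma Tr_square [simp]: "Tr l (x\<^sup>2) = Tr l (x::'a)"
proof -
  have "(\<Sum>i<l. (x\<^sup>2) ^ 2 ^ i) = (\<Sum>i<l. x ^ 2 ^ Suc i)"
    by (simp flip: power_mult)
  also have "\<dots> = (\<Sum>i<Suc l. x ^ 2 ^ i) - x"
    by (subst sum.lessThan_Suc_shift) simp
  also have "\<dots> = (\<Sum>i<l. x ^ 2 ^ i)"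
    using finite_field_power_card_eq_same[of x] card_field by (simp add: add.assoc)
  finally show ?thesis by (simp add: Tr_def)
qed

lemma l_pos: "0 < l"
proof (rule ccontr)
  assume "\<not> 0 < l"
  then have "card {0, 1 :: 'a} \<le> 1"
    using card_field card_mono[OF finite, of "{0, 1 :: 'a}" UNIV] by simp
  then show False by simp
qed

text \<open>A trace vanishing everywhere would give a nonzero polynomial of degree at most
  \<open>2^(l - 1)\<close> with \<open>2^l\<close> roots.\<close>

lemma Tr_surj: "\<exists>x::'a. Tr l x = 1"
proof (rule ccontr)
  assume "\<nexists>x::'a. Tr l x = 1"
  then have "Tr l x = 0" for x :: 'a
    by (metis bit_not_one_iff)
  then have root: "(\<Sum>i<l. x ^ 2 ^ i) = 0" for x :: 'a
    by (simp add: Tr_def split: if_splits)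
  define p :: "'a poly" where "p = (\<Sum>i<l. monom 1 (2 ^ i))"
  have "coeff p 1 = (\<Sum>i<l. if i = 0 then 1 else 0)"
    unfolding p_def coeff_sum by (intro sum.cong) auto
  then have "p \<noteq> 0" using l_pos by auto
  have "degree p \<le> 2 ^ (l - 1)"
    unfolding p_def
    by (intro degree_sum_le) (auto intro!: order.trans[OF degree_monom_le] power_increasing)
  moreover have "card {x. poly p x = 0} \<le> degree p"
    using \<open>p \<noteq> 0\<close> by (rule card_poly_roots_bound)
  moreover have "{x. poly p x = 0} = UNIV"
    using root by (simp add: p_def poly_sum poly_monom)
  ultimately have "(2::nat) ^ l \<le> 2 ^ (l - 1)"
    unfolding card_field[symmetric] by simp
  then have "l \<le> l - 1" by (subst (asm) power_increasing_iff) simp_all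
  then show False using l_pos by simp
qed

section \<open>The additive character of the field and counting solutions of trace equations\<close>

definition \<chi> :: "'a \<Rightarrow> int"
  where "\<chi> x = (if Tr l x = 0 then 1 else - 1)"

lemma \<chi>_add: "\<chi> (x + y) = \<chi> x * \<chi> y"
  by (cases "Tr l x"; cases "Tr l y") (simp_all add: \<chi>_def)

lemma \<chi>_0 [simp]: "\<chi> 0 = 1"
  by (simp add: \<chi>_def)

lemma \<chi>_sum: "\<chi> (sum f A) = (\<Prod>i\<in>A. \<chi> (f i))"
  by (induction A rule: infinite_finite_induct) (simp_all add: \<chi>_add)

text \<open>Orthogonality: for nonzero \<open>c\<close>, translation by \<open>y / c\<close> with
  \<open>Tr l y = 1\<close> changes the sign of every term.\<close>

lemma sum_\<chi>_mult: "(\<Sum>x\<in>UNIV. \<chi> (c * x)) = (if c = 0 then 2 ^ l else 0)"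
proof (cases "c = 0")
  case False
  obtain y where "Tr l (y::'a) = 1" using Tr_surj by blast
  then have y: "\<chi> (c * (y / c)) = - 1" using False by (simp add: \<chi>_def)
  have "(\<Sum>x\<in>UNIV. \<chi> (c * x)) = (\<Sum>x\<in>UNIV. \<chi> (c * (x + y / c)))"
    by (rule sum.reindex_bij_witness[of _ "\<lambda>x. x + y / c" "\<lambda>x. x + y / c"]) (simp_all add: add.assoc)
  also have "\<dots> = - (\<Sum>x\<in>UNIV. \<chi> (c * x))"
    by (simp only: distrib_left \<chi>_add y) (simp add: sum_negf)
  finally show ?thesis using False by simp
qed (simp add: card_field)

text \<open>Expanding \<open>\<Prod>j\<in>J. 1 + \<chi> (\<dots>)\<close>, only the empty subset of \<open>J\<close> survives the sum over \<open>x\<close>.\<close>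

lemma card_Tr_system:
  fixes v :: "'i \<Rightarrow> 'a"
  assumes "finite J" and indep: "\<And>T. T \<subseteq> J \<Longrightarrow> T \<noteq> {} \<Longrightarrow> sum v T \<noteq> 0"
  shows "2 ^ card J * card {x. \<forall>j\<in>J. Tr l (v j * x) = r j} = 2 ^ l"
proof -
  define s :: "'i \<Rightarrow> int" where "s j = (if r j = 0 then 1 else - 1)" for j
  have factor: "1 + s j * \<chi> (v j * x) = (if Tr l (v j * x) = r j then 2 else 0)" for j x
    by (cases "Tr l (v j * x)"; cases "r j") (simp_all add: s_def \<chi>_def)
  have "(\<Prod>j\<in>J. 1 + s j * \<chi> (v j * x)) = (if \<forall>j\<in>J. Tr l (v j * x) = r j then 2 ^ card J else 0)" for x
    unfolding factor using \<open>finite J\<close> by (auto simp: prod_zero_iff)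
  then have "(\<Sum>x\<in>UNIV. \<Prod>j\<in>J. 1 + s j * \<chi> (v j * x))
      = 2 ^ card J * int (card {x. \<forall>j\<in>J. Tr l (v j * x) = r j})"
    by (simp add: sum.If_cases)
  moreover have "(\<Sum>x\<in>UNIV. \<Prod>j\<in>J. 1 + s j * \<chi> (v j * x)) = 2 ^ l"
  proof -
    have "(\<Prod>j\<in>J. 1 + s j * \<chi> (v j * x)) = (\<Sum>T\<in>Pow J. prod s T * \<chi> (sum v T * x))" for x
      using prod_add[OF \<open>finite J\<close>, of "\<lambda>j. s j * \<chi> (v j * x)" "\<lambda>_. 1"]
      by (simp add: prod.distrib \<chi>_sum sum_distrib_right add.commute)
    then have "(\<Sum>x\<in>UNIV. \<Prod>j\<in>J. 1 + s j * \<chi> (v j * x))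
        = (\<Sum>T\<in>Pow J. prod s T * (\<Sum>x\<in>UNIV. \<chi> (sum v T * x)))"
      by (simp add: sum.swap[of _ UNIV] sum_distrib_left)
    also have "\<dots> = (\<Sum>T\<in>Pow J. if T = {} then 2 ^ l else 0)"
      using indep by (intro sum.cong) (auto simp: sum_\<chi>_mult)
    finally show ?thesis using \<open>finite J\<close> by simp
  qed
  ultimately have "int (2 ^ card J * card {x. \<forall>j\<in>J. Tr l (v j * x) = r j}) = int (2 ^ l)"
    by simp
  then show ?thesis by (simp only: of_nat_eq_iff)
qed

text \<open>\<open>C\<close> is a subgroup, so the sum of \<open>\<chi> (c * y)\<close> over
  \<open>C\<close> is \<open>card C\<close> if \<open>y\<close> annihilates \<open>C\<close>, and 0
  otherwise. Summing over all \<open>y\<close> first, only \<open>c = 0\<close> contributes.\<close>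

lemma card_annihilator:
  assumes "0 \<in> C" and closed: "\<And>x y. x \<in> C \<Longrightarrow> y \<in> C \<Longrightarrow> x + y \<in> C"
  shows "card C * card {y::'a. \<forall>c\<in>C. Tr l (c * y) = 0} = 2 ^ l"
proof -
  have "(\<Sum>c\<in>C. \<chi> (c * y)) = (if \<forall>c\<in>C. Tr l (c * y) = 0 then int (card C) else 0)" for y
  proof (cases "\<forall>c\<in>C. Tr l (c * y) = 0")
    case False
    then obtain d where d: "d \<in> C" "Tr l (d * y) \<noteq> 0" by blast
    have "(\<Sum>c\<in>C. \<chi> (c * y)) = (\<Sum>c\<in>C. \<chi> ((c + d) * y))"
      by (rule sum.reindex_bij_witness[of _ "\<lambda>x. x + d" "\<lambda>x. x + d"])
        (use d closed in \<open>simp_all add: add.assoc\<close>)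
    also have "\<dots> = - (\<Sum>c\<in>C. \<chi> (c * y))"
      using d(2) by (simp add: distrib_right \<chi>_add) (simp add: \<chi>_def sum_negf)
    finally have "(\<Sum>c\<in>C. \<chi> (c * y)) = 0" by simp
    with False show ?thesis by (simp only: if_False)
  qed (simp add: \<chi>_def)
  then have "(\<Sum>y\<in>UNIV. \<Sum>c\<in>C. \<chi> (c * y)) = int (card C * card {y. \<forall>c\<in>C. Tr l (c * y) = 0})"
    by (simp add: sum.If_cases)
  moreover have "(\<Sum>y\<in>UNIV. \<Sum>c\<in>C. \<chi> (c * y)) = int (2 ^ l)"
    using assms(1) by (subst sum.swap) (simp add: sum_\<chi>_mult)
  ultimately show ?thesis by (simp only: of_nat_eq_iff)
qed

text \<open>With only two scalars a dependence is a nonempty subfamily with zero sum; the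
  injectivity clause is the case of two-element subfamilies.\<close>

lemma B_indep_iff:
  fixes v :: "nat \<Rightarrow> 'a"
  assumes "finite I"
  shows "B_indep I v \<longleftrightarrow> (\<forall>T\<subseteq>I. T \<noteq> {} \<longrightarrow> sum v T \<noteq> 0)"
proof -
  interpret vector_space "bscale :: bit \<Rightarrow> 'a \<Rightarrow> 'a"
    by (rule vector_space_bscale[OF CHAR_eq_2])
  show ?thesis
  proof (intro iffI allI impI)
    fix T assume indep: "B_indep I v" and T: "T \<subseteq> I" "T \<noteq> {}"
    show "sum v T \<noteq> 0"
    proof
      assume "sum v T = 0"
      have inj: "inj_on v T"
        using indep T(1) by (meson B_indep_def inj_on_subset)
      have "(\<Sum>x\<in>v ` T. bscale 1 x) = 0"
        using \<open>sum v T = 0\<close> inj by (simp add: sum.reindex)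
      moreover have "\<exists>x\<in>v ` T. (1::bit) \<noteq> 0"
        using T(2) by auto
      moreover have "finite (v ` T)"
        using finite_subset[OF T(1) assms] by blast
      ultimately have "dependent (v ` T)"
        by (subst dependent_finite) (assumption, intro exI[of _ "\<lambda>_. 1"] conjI)
      moreover have "v ` T \<subseteq> v ` I"
        using T(1) by (rule image_mono)
      ultimately show False
        using indep dependent_mono unfolding B_indep_def by blast
    qed
  next
    assume *: "\<forall>T\<subseteq>I. T \<noteq> {} \<longrightarrow> sum v T \<noteq> 0"
    have inj: "inj_on v I"
    proof (rule inj_onI, rule ccontr)
      fix i j assume "i \<in> I" "j \<in> I" "v i = v j" "i \<noteq> j"
      then have "sum v {i, j} = 0" by simp
      then show False
        using *[rule_format, of "{i, j}"] \<open>i \<in> I\<close> \<open>j \<in> I\<close> by simp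
    qed
    moreover have "\<not> dependent (v ` I)"
    proof
      assume "dependent (v ` I)"
      then obtain u x where u: "x \<in> v ` I" "u x \<noteq> 0" "(\<Sum>x\<in>v ` I. bscale (u x) x) = 0"
        using assms by (subst (asm) dependent_finite) auto
      define T where "T = {i\<in>I. u (v i) = 1}"
      have "(\<Sum>x\<in>v ` I. bscale (u x) x) = (\<Sum>i\<in>I. if u (v i) = 1 then v i else 0)"
        unfolding sum.reindex[OF inj] o_def
      proof (rule sum.cong)
        show "bscale (u (v i)) (v i) = (if u (v i) = 1 then v i else 0)" for i
          by (cases "u (v i)") (simp_all add: bscale_def)
      qed simp
      also have "\<dots> = sum v T"
        using assms by (simp add: T_def sum.inter_filter)
      finally have "sum v T = 0" using u by simp
      moreover have "T \<noteq> {}" using u by (auto simp: T_def)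
      ultimately show False using * by (auto simp: T_def)
    qed
    ultimately show "B_indep I v" by (simp add: B_indep_def)
  qed
qed

text \<open>Independence makes the \<open>2^l\<close> subset sums distinct, and the field has no
  more elements than that.\<close>

lemma B_indep_spans:
  fixes v :: "nat \<Rightarrow> 'a"
  assumes "B_indep {1..l} v"
  obtains T where "T \<subseteq> {1..l}" "x = sum v T"
proof -
  have "inj_on (sum v) (Pow {1..l})"
  proof (rule inj_onI)
    fix S T assume ST: "S \<in> Pow {1..l}" "T \<in> Pow {1..l}" "sum v S = sum v T"
    moreover have "finite S" "finite T"
      using ST by (auto intro: finite_subset)
    ultimately have "sum v (sym_diff S T) = 0"
      using sum_symdiff[of S T v] by simp
    moreover have "sym_diff S T \<subseteq> {1..l}" using ST by blast
    ultimately have "sym_diff S T = {}"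
      using assms B_indep_iff[of "{1..l}" v] by blast
    then show "S = T" by blast
  qed
  then have "sum v ` Pow {1..l} = UNIV"
    by (intro card_subset_eq) (simp_all add: card_image card_Pow card_field)
  then show thesis using that by (metis UNIV_I imageE PowD)
qed

text \<open>Serves to turn the coefficients of the polynomials of a scheme into additive functions
  of their values at the failed node.\<close>

lemma B_indep_additive_extension:
  fixes v w :: "nat \<Rightarrow> 'a"
  assumes "B_indep I v"
  obtains f :: "'a \<Rightarrow> 'a" where "\<And>x y. f (x + y) = f x + f y" "\<And>i. i \<in> I \<Longrightarrow> f (v i) = w i"
proof -
  interpret vector_space_pair "bscale :: bit \<Rightarrow> 'a \<Rightarrow> 'a" "bscale :: bit \<Rightarrow> 'a \<Rightarrow> 'a"
    by (intro vector_space_pair.intro vector_space_bscale CHAR_eq_2)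
  have inj: "inj_on v I" and "\<not> vs1.dependent (v ` I)"
    using assms by (auto simp: B_indep_def)
  from linear_independent_extend[OF this(2), of "\<lambda>x. w (inv_into I v x)"]
  obtain f where f: "Vector_Spaces.linear bscale bscale f" "\<forall>x\<in>v ` I. f x = w (inv_into I v x)"
    by blast
  interpret f: Vector_Spaces.linear bscale bscale f by fact
  show thesis using that[of f] f inj by (simp add: f.add)
qed

section \<open>The lower bound on the I/O cost\<close>

lemma card_kernel_power_of_2:
  fixes f :: "'a \<Rightarrow> 'b::ab_group_add"
  assumes "\<And>x y. f (x + y) = f x + f y"
  obtains k where "card {x. f x = 0} = 2 ^ k"
proof -
  have "card {x. f x = 0} dvd 2 ^ l"
    using card_range_mult_card_kernel[of f] assms card_field by (metis dvd_triv_right)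
  then show thesis using that divides_primepow_nat[of 2] by auto
qed

text \<open>Otherwise the trace would vanish on \<open>b\<close> times the span of \<open>v\<close>,
  which is the whole field.\<close>

lemma B_indep_Tr_nonzero:
  fixes v :: "nat \<Rightarrow> 'a"
  assumes v: "B_indep {1..l} v" and "b \<noteq> 0"
  obtains j where "j \<in> {1..l}" "Tr l (v j * b) = 1"
proof (rule ccontr)
  assume "\<not> thesis"
  then have zero: "Tr l (v j * b) = 0" if "j \<in> {1..l}" for j
    using that \<open>\<And>j. j \<in> {1..l} \<Longrightarrow> Tr l (v j * b) = 1 \<Longrightarrow> thesis\<close> by (metis bit_not_one_iff)
  obtain y where y: "Tr l (y::'a) = 1" using Tr_surj by blast
  obtain T where T: "T \<subseteq> {1..l}" "y / b = sum v T" using B_indep_spans[OF v] by blast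
  have "y = sum v T * b" using T(2) \<open>b \<noteq> 0\<close> by (simp add: field_simps)
  then have "Tr l y = 0"
    using zero T(1) by (simp add: sum_distrib_right Tr_sum subset_iff)
  with y show False by simp
qed

text \<open>Since \<open>b\<close> is arbitrary, dependencies between columns are covered too: a sum of columns of
  \<open>W\<^sub>\<alpha>\<close> is zero iff \<open>\<alpha>\<close> is in \<open>zeros g b\<close> for the corresponding sum \<open>b\<close> of basis elements.\<close>

definition zeros :: "(nat \<Rightarrow> 'a poly) \<Rightarrow> 'a \<Rightarrow> 'a set"
  where "zeros g b = {\<alpha>. \<forall>j\<in>{1..l}. Tr l (poly (g j) \<alpha> * b) = 0}"

lemma nz_W: "nz (W l \<beta> g \<alpha>) = card {s\<in>{1..l}. \<alpha> \<notin> zeros g (\<beta> s)}"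
proof -
  have "col (W l \<beta> g \<alpha>) s \<noteq> 0\<^sub>v l \<longleftrightarrow> \<alpha> \<notin> zeros g (\<beta> (Suc s))" if "s < l" for s
  proof -
    have "col (W l \<beta> g \<alpha>) s = 0\<^sub>v l \<longleftrightarrow> (\<forall>j<l. Tr l (poly (g (Suc j)) \<alpha> * \<beta> (Suc s)) = 0)"
      using that by (auto simp: vec_eq_iff W_def)
    also have "\<dots> \<longleftrightarrow> \<alpha> \<in> zeros g (\<beta> (Suc s))"
      unfolding zeros_def image_Suc_lessThan[symmetric] by auto
    finally show ?thesis by simp
  qed
  then have "nz (W l \<beta> g \<alpha>) = card {s. s < l \<and> \<alpha> \<notin> zeros g (\<beta> (Suc s))}"
    unfolding nz_def by (intro arg_cong[where f = card]) (auto simp: W_def)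
  also have "\<dots> = card (Suc ` {s. s < l \<and> \<alpha> \<notin> zeros g (\<beta> (Suc s))})"
    by (simp add: card_image)
  also have "Suc ` {s. s < l \<and> \<alpha> \<notin> zeros g (\<beta> (Suc s))} = {s\<in>{1..l}. \<alpha> \<notin> zeros g (\<beta> s)}"
    unfolding image_Suc_lessThan[symmetric] by auto
  finally show ?thesis .
qed

lemma sum_card_zeros:
  assumes "\<And>s. s \<in> {1..l} \<Longrightarrow> a \<notin> zeros g (\<beta> s)"
  shows "(\<Sum>\<alpha>\<in>UNIV - {a}. card {s\<in>{1..l}. \<alpha> \<in> zeros g (\<beta> s)}) = (\<Sum>s\<in>{1..l}. card (zeros g (\<beta> s)))"
proof -
  have "{\<alpha>\<in>UNIV - {a}. \<alpha> \<in> zeros g (\<beta> s)} = zeros g (\<beta> s)" if "s \<in> {1..l}" for s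
    using assms[OF that] by auto
  then show ?thesis
    using sum_multicount_gen[of "UNIV - {a}" "{1..l}" "\<lambda>\<alpha> s. \<alpha> \<in> zeros g (\<beta> s)" "\<lambda>s. card (zeros g (\<beta> s))"]
    by simp
qed

text \<open>At each of the \<open>2^l - 1\<close> helper nodes the zero and nonzero columns add up
  to \<open>l\<close>, so a low cost is the same as many zero columns.\<close>

lemma io_cost_add_card_zeros:
  assumes "\<And>s. s \<in> {1..l} \<Longrightarrow> a \<notin> zeros g (\<beta> s)"
  shows "io_cost l UNIV a \<beta> g + (\<Sum>s\<in>{1..l}. card (zeros g (\<beta> s))) = (2 ^ l - 1) * l"
proof -
  have "nz (W l \<beta> g \<alpha>) + card {s\<in>{1..l}. \<alpha> \<in> zeros g (\<beta> s)} = l" for \<alpha>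
  proof -
    have "card ({s\<in>{1..l}. \<alpha> \<notin> zeros g (\<beta> s)} \<union> {s\<in>{1..l}. \<alpha> \<in> zeros g (\<beta> s)}) =
        nz (W l \<beta> g \<alpha>) + card {s\<in>{1..l}. \<alpha> \<in> zeros g (\<beta> s)}"
      unfolding nz_W by (rule card_Un_disjoint) auto
    moreover have "{s\<in>{1..l}. \<alpha> \<notin> zeros g (\<beta> s)} \<union> {s\<in>{1..l}. \<alpha> \<in> zeros g (\<beta> s)} = {1..l}"
      by auto
    ultimately show ?thesis by simp
  qed
  then have "io_cost l UNIV a \<beta> g + (\<Sum>\<alpha>\<in>UNIV - {a}. card {s\<in>{1..l}. \<alpha> \<in> zeros g (\<beta> s)})
      = (\<Sum>\<alpha>\<in>(UNIV :: 'a set) - {a}. l)"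
    unfolding io_cost_def sum.distrib[symmetric] by simp
  also have "\<dots> = (2 ^ l - 1) * l"
    by (simp add: card_field)
  finally show ?thesis
    using sum_card_zeros[OF assms] by simp
qed

section \<open>Schemes of quadratic polynomials as pairs of additive maps\<close>

lemma poly_degree_less_3:
  fixes p :: "'a poly"
  assumes "degree p < 3"
  shows "poly p x = coeff p 2 * (x + a)\<^sup>2 + coeff p 1 * (x + a) + poly p a"
proof -
  have "poly p y = coeff p 2 * y\<^sup>2 + coeff p 1 * y + coeff p 0" for y
  proof -
    have "poly p y = (\<Sum>i\<le>2. coeff p i * y ^ i)"
      using assms by (intro poly_as_sum_of_monoms'[THEN arg_cong, of p 2 "\<lambda>p. poly p y", THEN sym, THEN trans])
        (simp_all add: poly_sum poly_monom)
    then show ?thesis by (simp add: numeral_2_eq_2 algebra_simps)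
  qed
  \<comment> \<open>Squaring is additive, so moving the centre from 0 to \<open>a\<close> keeps both
    upper coefficients; every node can thus be treated like node 0.\<close>
  then show ?thesis by (simp add: square_add algebra_simps)
qed

text \<open>The trace is invariant under squaring, so the linear term can be traded for a multiple
  of \<open>x\<^sup>2\<close>. The whole expression becomes affine in \<open>x\<^sup>2\<close> over
  \<open>bit\<close>.\<close>

lemma Tr_quadratic:
  "Tr l ((p * x\<^sup>2 + q * x + r) * b) = Tr l (b * (p + b * q\<^sup>2) * x\<^sup>2) + Tr l (r * (b::'a))"
proof -
  have "Tr l (q * x * b) = Tr l ((q * x * b)\<^sup>2)" by simp
  also have "(q * x * b)\<^sup>2 = b * (b * q\<^sup>2) * x\<^sup>2"
    by (simp add: power2_eq_square)
  finally have "Tr l (q * x * b) = Tr l (b * (b * q\<^sup>2) * x\<^sup>2)" .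
  moreover have "(p * x\<^sup>2 + q * x + r) * b = b * p * x\<^sup>2 + q * x * b + r * b"
    by (simp add: algebra_simps)
  moreover have "b * (p + b * q\<^sup>2) * x\<^sup>2 = b * p * x\<^sup>2 + b * (b * q\<^sup>2) * x\<^sup>2"
    by (simp add: algebra_simps)
  ultimately show ?thesis by (simp only: Tr_add)
qed

text \<open>The values \<open>poly (h j) a\<close> form a basis. Hence the scheme amounts to one
  polynomial for every value \<omega> at \<open>a\<close>, whose upper coefficients
  \<open>lam \<omega>\<close> and \<open>eta \<omega>\<close> depend additively on \<omega>.\<close>

context
  fixes h :: "nat \<Rightarrow> 'a poly" and a :: 'a and lam eta :: "'a \<Rightarrow> 'a"
  assumes deg: "\<And>j. j \<in> {1..l} \<Longrightarrow> degree (h j) < 3"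
    and indep: "B_indep {1..l} (\<lambda>j. poly (h j) a)"
    and lam_add: "\<And>x y. lam (x + y) = lam x + lam y"
    and eta_add: "\<And>x y. eta (x + y) = eta x + eta y"
    and lam_coeff: "\<And>j. j \<in> {1..l} \<Longrightarrow> lam (poly (h j) a) = coeff (h j) 2"
    and eta_coeff: "\<And>j. j \<in> {1..l} \<Longrightarrow> eta (poly (h j) a) = coeff (h j) 1"
begin

text \<open>The value \<open>q \<omega>\<close> is additive in \<omega> and the values at
  \<open>a\<close> span, so the \<open>l\<close> conditions imply the condition for every
  \<omega>.\<close>

lemma zeros_iff:
  "\<alpha> \<in> zeros h b \<longleftrightarrow> (\<forall>\<omega>. Tr l ((lam \<omega> * (\<alpha> + a)\<^sup>2 + eta \<omega> * (\<alpha> + a) + \<omega>) * b) = 0)"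
proof -
  define q where "q \<omega> = lam \<omega> * (\<alpha> + a)\<^sup>2 + eta \<omega> * (\<alpha> + a) + \<omega>" for \<omega>
  have q_add: "q (x + y) = q x + q y" for x y
    by (simp add: q_def lam_add eta_add algebra_simps)
  have q_0: "q 0 = 0" using q_add[of 0 0] by simp
  have q_sum: "q (sum f T) = (\<Sum>i\<in>T. q (f i))" for f :: "nat \<Rightarrow> 'a" and T
    by (induction T rule: infinite_finite_induct) (simp_all add: q_0 q_add)
  have q_poly: "q (poly (h j) a) = poly (h j) \<alpha>" if "j \<in> {1..l}" for j
    using poly_degree_less_3[OF deg[OF that], of \<alpha> a] by (simp only: q_def lam_coeff[OF that] eta_coeff[OF that])
  have "Tr l (q \<omega> * b) = 0" if z: "\<alpha> \<in> zeros h b" for \<omega>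
  proof -
    obtain T where T: "T \<subseteq> {1..l}" "\<omega> = (\<Sum>j\<in>T. poly (h j) a)"
      using B_indep_spans[OF indep] by blast
    have "q \<omega> = (\<Sum>j\<in>T. poly (h j) \<alpha>)"
      unfolding T(2) q_sum using q_poly T(1) by (intro sum.cong) auto
    then show ?thesis
      using z T(1) by (simp add: sum_distrib_right Tr_sum zeros_def subset_iff)
  qed
  moreover have "\<alpha> \<in> zeros h b" if "\<forall>\<omega>. Tr l (q \<omega> * b) = 0"
    unfolding zeros_def using that by (simp flip: q_poly)
  ultimately show ?thesis unfolding q_def by blast
qed

text \<open>For such \<omega> the coefficient of the square in \<open>Tr_quadratic\<close> vanishes,
  and only the constant term is left.\<close>

lemma Tr_eq_0_if_zeros:
  assumes "\<alpha> \<in> zeros h b" "lam \<omega> = b * (eta \<omega>)\<^sup>2"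
  shows "Tr l (b * \<omega>) = 0"
  using assms(1)[unfolded zeros_iff, rule_format, of \<omega>, unfolded Tr_quadratic] assms(2)
  by (simp add: mult.commute)

text \<open>The squared difference of two zeros lies in the annihilator \<open>D\<close> of the
  range of \<open>f\<close>. By duality \<open>D\<close> is as large as the kernel of
  \<open>f\<close>, and squaring is injective.\<close>

lemma card_zeros_le:
  assumes "b \<noteq> 0"
  shows "card (zeros h b) \<le> card {\<omega>. lam \<omega> = b * (eta \<omega>)\<^sup>2}"
proof (cases "zeros h b = {}")
  case False
  then obtain \<alpha>0 where \<alpha>0: "\<alpha>0 \<in> zeros h b" by blast
  define f where "f \<omega> = b * (lam \<omega> + b * (eta \<omega>)\<^sup>2)" for \<omega>
  have f_add: "f (x + y) = f x + f y" for x y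
    by (simp add: f_def lam_add eta_add square_add algebra_simps)
  define D where "D = {y. \<forall>c\<in>range f. Tr l (c * y) = 0}"
  have "card (range f) * card D = 2 ^ l"
    unfolding D_def
  proof (rule card_annihilator)
    show "0 \<in> range f" using f_add[of 0 0] by (metis add_self rangeI)
    show "x + y \<in> range f" if "x \<in> range f" "y \<in> range f" for x y
      using that f_add by (auto simp flip: f_add)
  qed
  moreover have "card (range f) * card {\<omega>. f \<omega> = 0} = 2 ^ l"
    using card_range_mult_card_kernel[of f] f_add card_field by simp
  moreover have "{\<omega>. f \<omega> = 0} = {\<omega>. lam \<omega> = b * (eta \<omega>)\<^sup>2}"
    using \<open>b \<noteq> 0\<close> by (simp add: f_def)
  moreover have "card (range f) > 0" by (simp add: card_gt_0_iff)
  ultimately have card_D: "card D = card {\<omega>. lam \<omega> = b * (eta \<omega>)\<^sup>2}"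
    by (metis mult_left_cancel not_gr_zero)
  have "(\<alpha> + \<alpha>0)\<^sup>2 \<in> D" if \<alpha>: "\<alpha> \<in> zeros h b" for \<alpha>
  proof -
    have "Tr l (f \<omega> * (\<alpha> + \<alpha>0)\<^sup>2) = 0" for \<omega>
    proof -
      have "(\<alpha> + \<alpha>0)\<^sup>2 = (\<alpha> + a)\<^sup>2 + (\<alpha>0 + a)\<^sup>2"
        unfolding square_add[symmetric] by (metis add.assoc add.commute add_self add.right_neutral)
      then have "Tr l (f \<omega> * (\<alpha> + \<alpha>0)\<^sup>2) = Tr l (f \<omega> * (\<alpha> + a)\<^sup>2) + Tr l (f \<omega> * (\<alpha>0 + a)\<^sup>2)"
        by (simp only: distrib_left Tr_add)
      moreover have "Tr l (f \<omega> * (\<alpha> + a)\<^sup>2) + Tr l (\<omega> * b) = 0"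
        using \<alpha>[unfolded zeros_iff, rule_format, of \<omega>] unfolding Tr_quadratic f_def .
      moreover have "Tr l (f \<omega> * (\<alpha>0 + a)\<^sup>2) + Tr l (\<omega> * b) = 0"
        using \<alpha>0[unfolded zeros_iff, rule_format, of \<omega>] unfolding Tr_quadratic f_def .
      ultimately show ?thesis
        by (cases "Tr l (\<omega> * b)"; cases "Tr l (f \<omega> * (\<alpha> + a)\<^sup>2)"; cases "Tr l (f \<omega> * (\<alpha>0 + a)\<^sup>2)") simp_all
    qed
    then show ?thesis by (auto simp: D_def)
  qed
  moreover have "inj_on (\<lambda>\<alpha>. (\<alpha> + \<alpha>0)\<^sup>2) (zeros h b)"
    by (auto simp: inj_on_def square_inj)
  ultimately have "card (zeros h b) \<le> card D"
    by (intro card_inj_on_le) auto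
  then show ?thesis using card_D by simp
qed simp

text \<open>Dimensions are counted modulo the common kernel \<open>Z\<close> of \<open>lam\<close>
  and \<open>eta\<close>: the spaces \<open>K (\<beta> s)\<close> pairwise meet in \<open>Z\<close>,
  so \<open>sum_two_power_le\<close> applies with \<open>d = l - z\<close>.\<close>

lemma sum_card_zeros_le:
  assumes \<beta>: "B_indep {1..l} \<beta>"
  shows "(\<Sum>s\<in>{1..l}. card (zeros h (\<beta> s))) \<le> 2 ^ l"
proof -
  define K where "K b = {\<omega>. lam \<omega> = b * (eta \<omega>)\<^sup>2}" for b
  define Z where "Z = {\<omega>. lam \<omega> = 0 \<and> eta \<omega> = 0}"
  define S where "S = {s\<in>{1..l}. zeros h (\<beta> s) \<noteq> {}}"
  have S: "S \<subseteq> {1..l}" "finite S" by (auto simp: S_def)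
  have inj: "inj_on \<beta> {1..l}" using \<beta> by (simp add: B_indep_def)
  have sum_nz: "sum \<beta> T \<noteq> 0" if "T \<subseteq> {1..l}" "T \<noteq> {}" for T
    using \<beta> that by (simp add: B_indep_iff)
  have \<beta>_nz: "\<beta> s \<noteq> 0" if "s \<in> {1..l}" for s
    using sum_nz[of "{s}"] that by simp
  have "\<exists>k. card (K b) = 2 ^ k" for b
    by (rule card_kernel_power_of_2[of "\<lambda>\<omega>. lam \<omega> + b * (eta \<omega>)\<^sup>2"])
      (auto simp: K_def lam_add eta_add square_add algebra_simps)
  then obtain k where k: "card (K b) = 2 ^ k b" for b by metis
  obtain z where z: "card Z = 2 ^ z"
    by (rule card_kernel_power_of_2[of "\<lambda>\<omega>. (lam \<omega>, eta \<omega>)"])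
      (auto simp: Z_def lam_add eta_add zero_prod_def)
  have Z_le: "Z \<subseteq> K b" for b by (auto simp: K_def Z_def)
  have z_le: "z \<le> k b" for b
    using card_mono[OF finite Z_le[of b]] by (simp add: k z)
  have Tr_0: "Tr l (\<beta> s * \<omega>) = 0" if "s \<in> S" "\<omega> \<in> K (\<beta> s)" for s \<omega>
    using that Tr_eq_0_if_zeros by (auto simp: S_def K_def)
  \<comment> \<open>The \<open>card S\<close> independent functionals given by the
    \<open>\<beta> s\<close> all vanish on \<open>Z\<close>, so \<open>Z\<close> has codimension at
    least \<open>card S\<close>.\<close>
  have card_S: "card S + z \<le> l"
  proof -
    have "card Z \<le> card {\<omega>. \<forall>s\<in>S. Tr l (\<beta> s * \<omega>) = 0}"
      using Tr_0 Z_le by (intro card_mono) auto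
    then have "2 ^ card S * card Z \<le> 2 ^ card S * card {\<omega>. \<forall>s\<in>S. Tr l (\<beta> s * \<omega>) = 0}"
      by (intro mult_left_mono) auto
    also have "\<dots> = 2 ^ l"
      using sum_nz S by (intro card_Tr_system) auto
    finally show ?thesis by (simp add: z flip: power_add)
  qed
  \<comment> \<open>\<open>K (\<beta> s)\<close> lies in the hyperplane annihilated by
    \<open>\<beta> s\<close>.\<close>
  have k_less: "k (\<beta> s) < l" if "s \<in> S" for s
  proof -
    have "card (K (\<beta> s)) \<le> card {\<omega>. \<forall>s\<in>{s}. Tr l (\<beta> s * \<omega>) = 0}"
      using Tr_0 that by (intro card_mono) auto
    then have "2 ^ card {s} * card (K (\<beta> s)) \<le> 2 ^ card {s} * card {\<omega>. \<forall>s\<in>{s}. Tr l (\<beta> s * \<omega>) = 0}"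
      by (intro mult_left_mono) auto
    also have "\<dots> = 2 ^ l"
      using \<beta>_nz that S by (intro card_Tr_system) (auto simp: subset_singleton_iff)
    finally have "(2::nat) ^ Suc (k (\<beta> s)) \<le> 2 ^ l" by (simp add: k)
    then show ?thesis by (subst (asm) power_increasing_iff) auto
  qed
  have k_pair: "k (\<beta> s) + k (\<beta> t) \<le> l + z" if "s \<in> S" "t \<in> S" "s \<noteq> t" for s t
  proof -
    have "\<beta> s \<noteq> \<beta> t" using that inj S by (auto dest: inj_onD)
    \<comment> \<open>\<open>lam \<omega> = b * (eta \<omega>)\<^sup>2\<close> for two different
      \<open>b\<close> forces \<open>eta \<omega> = 0\<close> and then
      \<open>lam \<omega> = 0\<close>.\<close>
    then have "K (\<beta> s) \<inter> K (\<beta> t) = Z" by (auto simp: K_def Z_def)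
    moreover have "card (K (\<beta> s)) * card (K (\<beta> t)) \<le> CARD('a) * card (K (\<beta> s) \<inter> K (\<beta> t))"
      by (rule card_mult_card_le) (simp_all add: K_def lam_add eta_add square_add distrib_left)
    ultimately have "(2::nat) ^ (k (\<beta> s) + k (\<beta> t)) \<le> 2 ^ (l + z)"
      by (simp add: k z card_field power_add)
    then show ?thesis by simp
  qed
  have "(\<Sum>s\<in>{1..l}. card (zeros h (\<beta> s))) = (\<Sum>s\<in>S. card (zeros h (\<beta> s)))"
    by (rule sum.mono_neutral_right) (auto simp: S_def)
  also have "\<dots> \<le> (\<Sum>s\<in>S. card (K (\<beta> s)))"
    unfolding K_def using S \<beta>_nz by (intro sum_mono card_zeros_le) auto
  also have "\<dots> = (\<Sum>s\<in>S. 2 ^ z * 2 ^ (k (\<beta> s) - z))"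
    using z_le by (simp add: k flip: power_add)
  also have "\<dots> = 2 ^ z * (\<Sum>s\<in>S. 2 ^ (k (\<beta> s) - z))"
    by (simp add: sum_distrib_left)
  also have "\<dots> \<le> 2 ^ z * 2 ^ (l - z)"
  proof (rule mult_left_mono, rule sum_two_power_le)
    show "k (\<beta> s) - z < l - z" if "s \<in> S" for s
      using k_less[OF that] z_le[of "\<beta> s"] by simp
    show "k (\<beta> s) - z + (k (\<beta> t) - z) \<le> l - z" if "s \<in> S" "t \<in> S" "s \<noteq> t" for s t
      using k_pair[OF that] z_le[of "\<beta> s"] z_le[of "\<beta> t"] by simp
  qed (use S card_S in auto)
  also have "\<dots> = 2 ^ l"
    using card_S by (simp flip: power_add)
  finally show ?thesis .
qed

end

lemma zeros_node_empty:
  assumes "B_indep {1..l} (\<lambda>j. poly (h j) a)" "b \<noteq> 0"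
  shows "a \<notin> zeros h b"
  using B_indep_Tr_nonzero[OF assms] by (force simp: zeros_def)

lemma io_cost_lower_bound:
  fixes h :: "nat \<Rightarrow> 'a poly"
  assumes deg: "\<And>j. j \<in> {1..l} \<Longrightarrow> degree (h j) < 3"
    and indep: "B_indep {1..l} (\<lambda>j. poly (h j) a)"
    and \<beta>: "B_indep {1..l} \<beta>"
  shows "(2 ^ l - 1) * l \<le> io_cost l UNIV a \<beta> h + 2 ^ l"
proof -
  obtain lam where lam: "\<And>x y. lam (x + y) = lam x + lam y"
      "\<And>j. j \<in> {1..l} \<Longrightarrow> lam (poly (h j) a) = coeff (h j) 2"
    using B_indep_additive_extension[OF indep, of "\<lambda>j. coeff (h j) 2"] by blast
  obtain eta where eta: "\<And>x y. eta (x + y) = eta x + eta y"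
      "\<And>j. j \<in> {1..l} \<Longrightarrow> eta (poly (h j) a) = coeff (h j) 1"
    using B_indep_additive_extension[OF indep, of "\<lambda>j. coeff (h j) 1"] by blast
  have "\<beta> s \<noteq> 0" if "s \<in> {1..l}" for s
    using \<beta>[unfolded B_indep_iff[OF finite_atLeastAtMost], rule_format, of "{s}"] that by simp
  then have "io_cost l UNIV a \<beta> h + (\<Sum>s\<in>{1..l}. card (zeros h (\<beta> s))) = (2 ^ l - 1) * l"
    using zeros_node_empty[OF indep] by (intro io_cost_add_card_zeros) auto
  moreover have "(\<Sum>s\<in>{1..l}. card (zeros h (\<beta> s))) \<le> 2 ^ l"
    using sum_card_zeros_le[OF deg indep lam(1) eta(1) lam(2) eta(2) \<beta>] by blast
  ultimately show ?thesis by linarith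
qed

lemma zeros_add:
  assumes "\<alpha> \<in> zeros g b" "\<alpha> \<in> zeros g c"
  shows "\<alpha> \<in> zeros g (b + c)"
  using assms by (simp add: zeros_def distrib_left)

lemma square_sum: "(sum f A)\<^sup>2 = (\<Sum>i\<in>A. (f i :: 'a)\<^sup>2)"
  by (induction A rule: infinite_finite_induct) (simp_all add: square_add)

text \<open>Squaring permutes the field, so \<open>card_Tr_system\<close> carries over.\<close>

lemma card_Tr_system_square:
  fixes v :: "'i \<Rightarrow> 'a"
  assumes "finite J" "\<And>T. T \<subseteq> J \<Longrightarrow> T \<noteq> {} \<Longrightarrow> sum v T \<noteq> 0"
  shows "2 ^ card J * card {x. \<forall>j\<in>J. Tr l (v j * x\<^sup>2) = r j} = 2 ^ l"
proof -
  have "inj (\<lambda>x::'a. x\<^sup>2)" by (simp add: inj_def square_inj)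
  then have surj: "surj (\<lambda>x::'a. x\<^sup>2)" by (rule finite_UNIV_inj_surj[OF finite])
  have "bij_betw (\<lambda>x. x\<^sup>2) {x. \<forall>j\<in>J. Tr l (v j * x\<^sup>2) = r j} {x. \<forall>j\<in>J. Tr l (v j * x) = r j}"
    unfolding bij_betw_def
  proof
    show "(\<lambda>x. x\<^sup>2) ` {x. \<forall>j\<in>J. Tr l (v j * x\<^sup>2) = r j} = {x. \<forall>j\<in>J. Tr l (v j * x) = r j}"
    proof (intro Set.set_eqI iffI)
      fix y assume y: "y \<in> {x. \<forall>j\<in>J. Tr l (v j * x) = r j}"
      obtain x where "y = x\<^sup>2" using surj by (metis surjD)
      with y show "y \<in> (\<lambda>x. x\<^sup>2) ` {x. \<forall>j\<in>J. Tr l (v j * x\<^sup>2) = r j}" by auto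
    qed auto
  qed (simp add: inj_on_def square_inj)
  from bij_betw_same_card[OF this] show ?thesis
    using card_Tr_system[OF assms, of r] by simp
qed

end

section \<open>The construction\<close>

locale repair_construction = binary_field l F
  for l :: nat and F :: "'a::finite_field itself" +
  fixes \<zeta> \<theta> :: 'a and \<beta> \<gamma> \<eta> \<omega> lam :: "nat \<Rightarrow> 'a" and g :: "nat \<Rightarrow> 'a poly"
  assumes l_ge: "l \<ge> 4"
    and zeta: "\<zeta>\<^sup>2 + \<zeta> + 1 = 0"
    and primitive: "primitive_element \<theta>"
    and beta: "\<beta> 1 = (\<theta>\<^sup>2 + (\<zeta> + 1) * \<theta> + 1)\<^sup>2" "\<beta> 2 = (\<zeta> * \<theta>)\<^sup>2" "\<beta> 3 = 1" "\<beta> 4 = (\<theta> + 1)\<^sup>2"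
    and basis: "B_indep {1..l} \<beta>"
    and dual: "\<And>i j. i \<in> {1..l} \<Longrightarrow> j \<in> {1..l} \<Longrightarrow> Tr l (\<beta> i * \<gamma> j) = (if i = j then 1 else 0)"
    and eta: "\<eta> 1 = 1" "\<eta> 2 = \<zeta>" "\<eta> 3 = \<zeta> * \<theta>" "\<eta> 4 = \<theta>"
    and omega: "\<omega> 1 = \<gamma> 3" "\<omega> 2 = \<gamma> 2 + \<gamma> 4" "\<omega> 3 = \<gamma> 1 + \<gamma> 3" "\<omega> 4 = \<gamma> 4"
    and lam: "\<And>j. j \<in> {1, 2} \<Longrightarrow> lam j = (\<eta> j)\<^sup>2 * \<beta> 1" "\<And>j. j \<in> {3, 4} \<Longrightarrow> lam j = (\<eta> j)\<^sup>2 * \<beta> 2"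
    and g_low: "\<And>j. j \<in> {1..4} \<Longrightarrow> g j = [:\<omega> j, \<eta> j, lam j:]"
    and g_high: "\<And>j. j \<in> {5..l} \<Longrightarrow> g j = [:\<gamma> j:]"
begin

declare One_nat_def [simp del]

lemma one_to_four: "{1..4} = {1, 2, 3, 4::nat}"
  by auto

lemma sum_low:
  fixes f :: "nat \<Rightarrow> 'b::comm_monoid_add"
  assumes "T \<subseteq> {1..4}"
  shows "sum f T = (if 1 \<in> T then f 1 else 0) + ((if 2 \<in> T then f 2 else 0)
    + ((if 3 \<in> T then f 3 else 0) + (if 4 \<in> T then f 4 else 0)))"
proof -
  have "sum f T = sum f {j\<in>{1..4}. j \<in> T}"
    using assms by (intro sum.cong) auto
  also have "\<dots> = (\<Sum>j\<in>{1..4}. if j \<in> T then f j else 0)"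
    by (rule sum.inter_filter) simp
  finally show ?thesis unfolding one_to_four by simp
qed

lemma beta_sum: "T \<subseteq> {1..4} \<Longrightarrow> T \<noteq> {} \<Longrightarrow> sum \<beta> T \<noteq> 0"
  using basis[unfolded B_indep_iff[OF finite_atLeastAtMost]] l_ge by (meson atLeastatMost_subset_iff le_refl subset_trans)

lemma beta_nonzero: "s \<in> {1..4} \<Longrightarrow> \<beta> s \<noteq> 0"
  using beta_sum[of "{s}"] by simp

lemma beta_neq: "s \<in> {1..4} \<Longrightarrow> t \<in> {1..4} \<Longrightarrow> s \<noteq> t \<Longrightarrow> \<beta> s \<noteq> \<beta> t"
  using beta_sum[of "{s, t}"] by simp

lemma zeta_sq: "\<zeta> * \<zeta> = \<zeta> + 1" "\<zeta> * (\<zeta> * x) = \<zeta> * x + x"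
proof -
  show zz: "\<zeta> * \<zeta> = \<zeta> + 1"
    using zeta by (simp add: power2_eq_square add.assoc)
  show "\<zeta> * (\<zeta> * x) = \<zeta> * x + x"
    unfolding mult.assoc[symmetric] zz by (simp add: distrib_right)
qed

lemma add_left_self: "x + (x + y) = (y::'a)"
  by (simp flip: add.assoc)

text \<open>A normal form for polynomials in \<zeta> and \<theta>: products are expanded,
  \<open>\<zeta> * \<zeta>\<close> becomes \<open>\<zeta> + 1\<close>, equal summands
  cancel.\<close>

lemmas norm_simps = zeta_sq add_left_self power2_eq_square distrib_left distrib_right
  mult.assoc mult.commute mult.left_commute add.assoc add.commute add.left_commute

text \<open>The square root of \<open>lam j / (\<eta> j)\<^sup>2\<close> for \<open>j\<close> up to
  4: it is the root of \<open>\<beta> 1\<close> for the first two rows and of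
  \<open>\<beta> 2\<close> for the next two.\<close>

definition slope :: "nat \<Rightarrow> 'a"
  where "slope j = (if j \<le> 2 then \<theta>\<^sup>2 + (\<zeta> + 1) * \<theta> + 1 else \<zeta> * \<theta>)"

lemma slope_square: "(slope 1)\<^sup>2 = \<beta> 1" "(slope 3)\<^sup>2 = \<beta> 2"
  by (simp_all add: slope_def beta)

text \<open>The coefficient of the squared node in row \<open>j\<close>, once the linear term has
  been absorbed by \<open>Tr_quadratic\<close>.\<close>

definition row_coeff :: "nat \<Rightarrow> 'a \<Rightarrow> 'a"
  where "row_coeff j b = b * (lam j + b * (\<eta> j)\<^sup>2)"

lemma lam_square:
  assumes "j \<in> {1..4}"
  shows "lam j = (\<eta> j * slope j)\<^sup>2"
proof -
  from assms consider "j \<in> {1, 2}" | "j \<in> {3, 4}" by fastforce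
  then show ?thesis
    by cases (auto simp: lam beta slope_def power_mult_distrib)
qed

lemma sum_row_coeff:
  assumes "T \<subseteq> {1..4}"
  shows "(\<Sum>j\<in>T. row_coeff j b) = b * ((\<Sum>j\<in>T. \<eta> j * slope j)\<^sup>2 + b * (sum \<eta> T)\<^sup>2)"
proof -
  have "(\<Sum>j\<in>T. row_coeff j b) = (\<Sum>j\<in>T. b * ((\<eta> j * slope j)\<^sup>2 + b * (\<eta> j)\<^sup>2))"
    using assms by (intro sum.cong) (auto simp: row_coeff_def lam_square)
  then show ?thesis
    unfolding square_sum by (simp add: sum_distrib_left sum.distrib distrib_left)
qed

lemma Tr_row:
  "j \<in> {1..4} \<Longrightarrow> Tr l (poly (g j) \<alpha> * b) = Tr l (row_coeff j b * \<alpha>\<^sup>2) + Tr l (\<omega> j * b)"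
  using Tr_quadratic[of "lam j" \<alpha> "\<eta> j" "\<omega> j" b]
  by (simp add: g_low row_coeff_def power2_eq_square algebra_simps)

lemma card_rows:
  assumes J: "J \<subseteq> {1..4}" and indep: "\<And>T. T \<subseteq> J \<Longrightarrow> T \<noteq> {} \<Longrightarrow> (\<Sum>j\<in>T. row_coeff j b) \<noteq> 0"
  shows "2 ^ card J * card {\<alpha>. \<forall>j\<in>J. Tr l (poly (g j) \<alpha> * b) = 0} = 2 ^ l"
proof -
  have "{\<alpha>. \<forall>j\<in>J. Tr l (poly (g j) \<alpha> * b) = 0} = {\<alpha>. \<forall>j\<in>J. Tr l (row_coeff j b * \<alpha>\<^sup>2) = Tr l (\<omega> j * b)}"
    using J by (auto simp: Tr_row subset_iff)
  then show ?thesis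
    using card_Tr_system_square[of J "\<lambda>j. row_coeff j b"] indep J finite_subset by fastforce
qed

lemma Tr_gamma: "i \<in> {1..l} \<Longrightarrow> j \<in> {1..l} \<Longrightarrow> Tr l (\<gamma> j * \<beta> i) = (if i = j then 1 else 0)"
  using dual[of i j] by (simp add: mult.commute)

text \<open>Each excluded value would break independence: 0 gives \<open>\<beta> 2 = 0\<close>, 1
  gives \<open>\<beta> 4 = 0\<close>, \<zeta> gives \<open>\<beta> 1 = \<beta> 4\<close>, and
  \<open>\<zeta> + 1\<close> gives \<open>\<beta> 1 = \<beta> 3\<close>.\<close>

lemma theta_not_in_F4: "\<theta> \<notin> {0, 1, \<zeta>, \<zeta> + 1}"
proof -
  have "\<theta> \<noteq> 0" "\<theta> \<noteq> 1" using beta_nonzero[of 2] beta_nonzero[of 4] by (auto simp: beta)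
  moreover have "\<theta> \<noteq> \<zeta>"
    using beta_neq[of 1 4] unfolding beta square_inj by (auto simp: norm_simps)
  moreover have "\<theta> \<noteq> \<zeta> + 1"
    using beta_neq[of 1 3] unfolding beta by (auto simp: norm_simps)
  ultimately show ?thesis by simp
qed

lemma zeta_neq: "\<zeta> \<noteq> 0" "\<zeta> \<noteq> 1"
  using zeta_sq(1) by auto

text \<open>The four listed elements form a subfield, so a nontrivial relation would put \<theta> in
  it.\<close>

lemma F4_independent:
  assumes a: "a \<in> {0, 1, \<zeta>, \<zeta> + 1}" and b: "b \<in> {0, 1, \<zeta>, \<zeta> + 1}" and "a + b * \<theta> = 0"
  shows "a = 0 \<and> b = 0"
proof (rule ccontr)
  assume "\<not> (a = 0 \<and> b = 0)"
  then have "b \<noteq> 0" using assms(3) by auto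
  then obtain c where c: "c \<in> {0, 1, \<zeta>, \<zeta> + 1}" "c * b = 1"
  proof -
    consider "b = 1" | "b = \<zeta>" | "b = \<zeta> + 1" using b \<open>b \<noteq> 0\<close> by auto
    then show thesis
      by cases (rule that[of 1] that[of "\<zeta> + 1"] that[of \<zeta>]; simp add: norm_simps)+
  qed
  have "c * a + (c * b) * \<theta> = c * (a + b * \<theta>)"
    by (simp add: algebra_simps)
  then have "\<theta> = c * a" using c assms(3) by simp
  moreover have "c * a \<in> {0, 1, \<zeta>, \<zeta> + 1}"
    using a c(1) by (auto simp: norm_simps)
  ultimately show False using theta_not_in_F4 by simp
qed

text \<open>Any such sum has the form \<open>a + b * \<theta>\<close> with \<open>a\<close> and
  \<open>b\<close> in the field of four elements, where 1 and \<zeta> are independent.\<close>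

lemma sum_eta_nonzero:
  assumes "T \<subseteq> {1..4}" "T \<noteq> {}"
  shows "sum \<eta> T \<noteq> 0"
proof
  assume zero: "sum \<eta> T = 0"
  define a where "a = (if 1 \<in> T then 1 else 0) + (if 2 \<in> T then \<zeta> else 0)"
  define b where "b = (if 3 \<in> T then \<zeta> else 0) + (if 4 \<in> T then 1 else 0)"
  have "a + b * \<theta> = 0"
    using zero unfolding sum_low[OF assms(1)] eta a_def b_def by (simp add: distrib_right add.assoc)
  moreover have "a \<in> {0, 1, \<zeta>, \<zeta> + 1}" "b \<in> {0, 1, \<zeta>, \<zeta> + 1}"
    by (auto simp: a_def b_def add.commute)
  ultimately have "a = 0" "b = 0" using F4_independent by blast+
  then have "1 \<notin> T" "2 \<notin> T" "3 \<notin> T" "4 \<notin> T"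
    using zeta_neq by (auto simp: a_def b_def split: if_splits)
  then have "T = {}" using assms(1) unfolding one_to_four by auto
  with assms(2) show False by simp
qed

text \<open>The quotient \<open>x/y\<close> takes only five values.  The combinations of rows with a given value
  form one of the five planes of a spread of the four-dimensional row space.\<close>

lemma row_directions:
  assumes "T \<subseteq> {1..4}" "T \<noteq> {}"
  defines "x \<equiv> \<Sum>j\<in>T. \<eta> j * slope j" and "y \<equiv> sum \<eta> T"
  shows "x = slope 1 * y \<or> x = slope 3 * y \<or> x = 1 * y \<or> x = (\<theta> + 1) * y \<or> x * (\<theta> + 1) = (slope 1 + \<theta> * slope 3) * y"
  unfolding x_def y_def sum_low[OF assms(1)]
  using assms(2) assms(1)
  by (cases "1 \<in> T"; cases "2 \<in> T"; cases "3 \<in> T"; cases "4 \<in> T"; simp add: eta slope_def norm_simps)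

text \<open>A vanishing combination forces \<open>b = (x/y)\<^sup>2\<close>. Of the five possible
  values of \<open>x/y\<close>, four have the squares \<open>\<beta> 1\<close> to
  \<open>\<beta> 4\<close>, and the fifth is excluded by the last condition on
  \<open>b\<close>.\<close>

lemma rows_independent:
  assumes b: "b \<noteq> 0" "\<And>i. i \<in> {1..4} \<Longrightarrow> b \<noteq> \<beta> i" "b * (\<theta> + 1)\<^sup>2 \<noteq> (slope 1 + \<theta> * slope 3)\<^sup>2"
    and T: "T \<subseteq> {1..4}" "T \<noteq> {}"
  shows "(\<Sum>j\<in>T. row_coeff j b) \<noteq> 0"
proof
  define x y where "x = (\<Sum>j\<in>T. \<eta> j * slope j)" and "y = sum \<eta> T"
  assume "(\<Sum>j\<in>T. row_coeff j b) = 0"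
  then have eq: "x\<^sup>2 = b * y\<^sup>2"
    using b(1) by (simp add: sum_row_coeff[OF T(1)] x_def y_def)
  have y: "y \<noteq> 0" using sum_eta_nonzero[OF T] by (simp add: y_def)
  have ratio: "b = r\<^sup>2" if "x = r * y" for r
    using eq y unfolding that by (simp add: power_mult_distrib)
  have "x * (\<theta> + 1) \<noteq> (slope 1 + \<theta> * slope 3) * y"
  proof
    assume "x * (\<theta> + 1) = (slope 1 + \<theta> * slope 3) * y"
    then have "x\<^sup>2 * (\<theta> + 1)\<^sup>2 = (slope 1 + \<theta> * slope 3)\<^sup>2 * y\<^sup>2"
      by (simp flip: power_mult_distrib)
    then show False using b(3) eq y by simp
  qed
  moreover have "slope 1 ^ 2 = \<beta> 1" "slope 3 ^ 2 = \<beta> 2" "1 ^ 2 = \<beta> 3" "(\<theta> + 1)\<^sup>2 = \<beta> 4"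
    by (simp_all add: slope_def beta)
  ultimately show False
    using row_directions[OF T] ratio b(2)[of 1] b(2)[of 2] b(2)[of 3] b(2)[of 4]
    unfolding x_def y_def by auto
qed

text \<open>Rows 1 and 2 share their slope, so every combination of them is
  \<open>b * (\<beta> 1 + b)\<close> times a nonzero square.\<close>

lemma rows_12_independent:
  assumes "b \<noteq> 0" "b \<noteq> \<beta> 1" "T \<subseteq> {1, 2}" "T \<noteq> {}"
  shows "(\<Sum>j\<in>T. row_coeff j b) \<noteq> 0"
proof -
  have T: "T \<subseteq> {1..4}" using assms(3) by auto
  have "(\<Sum>j\<in>T. \<eta> j * slope j) = (\<Sum>j\<in>T. slope 1 * \<eta> j)"
    using assms(3) by (intro sum.cong) (auto simp: slope_def)
  also have "\<dots> = slope 1 * sum \<eta> T"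
    by (simp add: sum_distrib_left)
  finally have "(\<Sum>j\<in>T. row_coeff j b) = b * (\<beta> 1 + b) * (sum \<eta> T)\<^sup>2"
    by (simp add: sum_row_coeff[OF T] power_mult_distrib slope_square distrib_right distrib_left)
  then show ?thesis using assms sum_eta_nonzero[OF T assms(4)] by auto
qed

lemma rows_34_independent:
  assumes "b \<noteq> 0" "b \<noteq> \<beta> 2" "T \<subseteq> {3, 4}" "T \<noteq> {}"
  shows "(\<Sum>j\<in>T. row_coeff j b) \<noteq> 0"
proof -
  have T: "T \<subseteq> {1..4}" using assms(3) by auto
  have "(\<Sum>j\<in>T. \<eta> j * slope j) = (\<Sum>j\<in>T. slope 3 * \<eta> j)"
    using assms(3) by (intro sum.cong) (auto simp: slope_def)
  also have "\<dots> = slope 3 * sum \<eta> T"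
    by (simp add: sum_distrib_left)
  finally have "(\<Sum>j\<in>T. row_coeff j b) = b * (\<beta> 2 + b) * (sum \<eta> T)\<^sup>2"
    by (simp add: sum_row_coeff[OF T] power_mult_distrib slope_square distrib_right distrib_left)
  then show ?thesis using assms sum_eta_nonzero[OF T assms(4)] by auto
qed

section \<open>Entries of the first four columns and their zero sets\<close>

lemma Tr_omega:
  "i \<in> {1..4} \<Longrightarrow> Tr l (\<omega> 1 * \<beta> i) = (if i = 3 then 1 else 0)"
  "i \<in> {1..4} \<Longrightarrow> Tr l (\<omega> 2 * \<beta> i) = (if i = 2 \<or> i = 4 then 1 else 0)"
  "i \<in> {1..4} \<Longrightarrow> Tr l (\<omega> 3 * \<beta> i) = (if i = 1 \<or> i = 3 then 1 else 0)"
  "i \<in> {1..4} \<Longrightarrow> Tr l (\<omega> 4 * \<beta> i) = (if i = 4 then 1 else 0)"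
  using l_ge by (auto simp: omega distrib_right Tr_gamma)

text \<open>The form of \<open>lam\<close> kills the square in two rows of columns 1 and 2, and in
  columns 3 and 4 it makes the coefficients of rows 3 and 4 sums of those of rows 1 and 2. The
  \<open>\<omega> j\<close> are such that the constant terms obey the same relations, so two rows
  determine each column.\<close>

lemma Tr_entries:
  fixes \<alpha> :: 'a
  defines "X \<equiv> \<lambda>j i. Tr l (poly (g j) \<alpha> * \<beta> i)"
  shows "X 1 1 = 0" "X 2 1 = 0" "X 3 2 = 0" "X 4 2 = 0"
    "X 3 3 = X 1 3 + X 2 3" "X 4 3 = X 2 3" "X 3 4 = X 1 4" "X 4 4 = X 1 4 + X 2 4"
proof -
  have c: "row_coeff 1 (\<beta> 1) = 0" "row_coeff 2 (\<beta> 1) = 0" "row_coeff 3 (\<beta> 2) = 0" "row_coeff 4 (\<beta> 2) = 0"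
    by (simp_all add: row_coeff_def lam mult.commute)
  have d: "row_coeff 3 (\<beta> 3) = row_coeff 1 (\<beta> 3) + row_coeff 2 (\<beta> 3)" "row_coeff 4 (\<beta> 3) = row_coeff 2 (\<beta> 3)"
    "row_coeff 3 (\<beta> 4) = row_coeff 1 (\<beta> 4)" "row_coeff 4 (\<beta> 4) = row_coeff 1 (\<beta> 4) + row_coeff 2 (\<beta> 4)"
    by (simp_all add: row_coeff_def lam eta beta norm_simps)
  show "X 3 3 = X 1 3 + X 2 3"
    by (cases "Tr l (row_coeff 1 (\<beta> 3) * \<alpha>\<^sup>2)"; cases "Tr l (row_coeff 2 (\<beta> 3) * \<alpha>\<^sup>2)")
      (simp_all add: X_def Tr_row Tr_omega d distrib_right)
  show "X 1 1 = 0" "X 2 1 = 0" "X 3 2 = 0" "X 4 2 = 0"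
    "X 4 3 = X 2 3" "X 3 4 = X 1 4" "X 4 4 = X 1 4 + X 2 4"
    by (simp_all add: X_def Tr_row Tr_omega c d distrib_right)
qed

text \<open>Rows beyond the fourth are constant dual basis elements and vanish on the span of
  \<open>\<beta> 1\<close> to \<open>\<beta> 4\<close>.\<close>

lemma zeros_low:
  assumes "u \<subseteq> {1..4}"
  shows "zeros g (sum \<beta> u) = {\<alpha>. \<forall>j\<in>{1..4}. Tr l (poly (g j) \<alpha> * sum \<beta> u) = 0}"
proof -
  have "Tr l (poly (g j) \<alpha> * sum \<beta> u) = 0" if "j \<in> {1..l}" "j \<notin> {1..4}" for j \<alpha>
  proof -
    have "Tr l (\<gamma> j * \<beta> i) = 0" if "i \<in> u" for i
      using Tr_gamma[of i j] that \<open>j \<in> {1..l}\<close> \<open>j \<notin> {1..4}\<close> assms l_ge by auto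
    then show ?thesis
      using that by (simp add: g_high sum_distrib_left Tr_sum)
  qed
  then show ?thesis using l_ge by (force simp: zeros_def)
qed

lemma zeros_low1:
  "i \<in> {1..4} \<Longrightarrow> zeros g (\<beta> i) = {\<alpha>. \<forall>j\<in>{1..4}. Tr l (poly (g j) \<alpha> * \<beta> i) = 0}"
  using zeros_low[of "{i}"] by simp

lemma zeros_high:
  assumes "i \<in> {5..l}"
  shows "zeros g (\<beta> i) = {}"
proof -
  have i: "i \<in> {1..l}" using assms by auto
  have "Tr l (poly (g i) \<alpha> * \<beta> i) = 1" for \<alpha>
    using Tr_gamma[OF i i] assms by (simp add: g_high)
  then show ?thesis
    using i unfolding zeros_def by (metis (mono_tags, lifting) Collect_empty_eq zero_neq_one)
qed

lemma zeros_rows: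
  "zeros g (\<beta> 1) = {\<alpha>. \<forall>j\<in>{3, 4}. Tr l (poly (g j) \<alpha> * \<beta> 1) = 0}"
  "zeros g (\<beta> 2) = {\<alpha>. \<forall>j\<in>{1, 2}. Tr l (poly (g j) \<alpha> * \<beta> 2) = 0}"
  "zeros g (\<beta> 3) = {\<alpha>. \<forall>j\<in>{1, 2}. Tr l (poly (g j) \<alpha> * \<beta> 3) = 0}"
  "zeros g (\<beta> 4) = {\<alpha>. \<forall>j\<in>{1, 2}. Tr l (poly (g j) \<alpha> * \<beta> 4) = 0}"
  by (auto simp: zeros_low1 one_to_four Tr_entries)

text \<open>By \<open>zeros_rows\<close> two conditions remain in each column; they are independent,
  and so leave a quarter of the nodes.\<close>

lemma card_zeros:
  assumes "i \<in> {1..4}"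
  shows "4 * card (zeros g (\<beta> i)) = 2 ^ l"
proof -
  have "card {3, 4::nat} = 2" "card {1, 2::nat} = 2" by simp_all
  note * = beta_nonzero[OF assms] beta_neq[OF assms]
  consider "i = 1" | "i = 2" | "i = 3" | "i = 4" using assms by fastforce
  then show ?thesis
  proof cases
    case 1
    then show ?thesis
      using card_rows[of "{3, 4}" "\<beta> 1", OF _ rows_34_independent] * by (simp add: zeros_rows)
  next
    case 2
    then show ?thesis
      using card_rows[of "{1, 2}" "\<beta> 2", OF _ rows_12_independent] * by (simp add: zeros_rows)
  next
    case 3
    then show ?thesis
      using card_rows[of "{1, 2}" "\<beta> 3", OF _ rows_12_independent] * by (simp add: zeros_rows)
  next
    case 4
    then show ?thesis
      using card_rows[of "{1, 2}" "\<beta> 4", OF _ rows_12_independent] * by (simp add: zeros_rows)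
  qed
qed

lemma sum_card_zeros_eq: "(\<Sum>i\<in>{1..l}. card (zeros g (\<beta> i))) = 2 ^ l"
proof -
  have "(\<Sum>i\<in>{1..l}. card (zeros g (\<beta> i))) = (\<Sum>i\<in>{1..4}. card (zeros g (\<beta> i)))"
    using l_ge zeros_high by (intro sum.mono_neutral_right) auto
  moreover have "4 * (\<Sum>i\<in>{1..4}. card (zeros g (\<beta> i))) = (\<Sum>i\<in>{1..4::nat}. 2 ^ l)"
    unfolding sum_distrib_left using card_zeros by (intro sum.cong) auto
  ultimately show ?thesis by simp
qed

text \<open>The traces against \<open>\<beta> i\<close> are coordinates in the dual basis: from
  index 5 on the values at 0 are dual basis elements, and \<open>\<omega> 1\<close> to
  \<open>\<omega> 4\<close> are an invertible transform of the first four.\<close>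

lemma node_independent: "B_indep {1..l} (\<lambda>j. poly (g j) 0)"
  unfolding B_indep_iff[OF finite_atLeastAtMost]
proof (intro allI impI notI)
  fix T assume T: "T \<subseteq> {1..l}" "T \<noteq> {}" and zero: "(\<Sum>j\<in>T. poly (g j) 0) = 0"
  define c where "c j i = Tr l (poly (g j) 0 * \<beta> i)" for j i
  have sum0: "(\<Sum>j\<in>T. c j i) = 0" for i
    using zero unfolding c_def Tr_sum[symmetric] sum_distrib_right[symmetric] by simp
  have c_low: "c j i = Tr l (\<omega> j * \<beta> i)" if "j \<in> {1..4}" for i j
    using that by (simp add: c_def g_low)
  have c_high: "c j i = (if i = j then 1 else 0)" if "j \<in> T" "j \<notin> {1..4}" "i \<in> {1..l}" for i j
    using that T(1) Tr_gamma[of i j] by (auto simp: c_def g_high subset_iff)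
  have fin: "finite T" using T(1) finite_subset by blast
  have split: "(\<Sum>j\<in>T \<inter> {1..4}. c j i) + (\<Sum>j\<in>T - {1..4}. c j i) = 0" for i
    using sum0[of i] sum.Int_Diff[OF fin, of "\<lambda>j. c j i" "{1..4}"] by simp
  have "T - {1..4} = {}"
  proof (rule ccontr)
    assume "T - {1..4} \<noteq> {}"
    then obtain i where i: "i \<in> T" "i \<notin> {1..4}" by blast
    have "(\<Sum>j\<in>T \<inter> {1..4}. c j i) = 0"
      using i T(1) l_ge by (intro sum.neutral ballI) (auto simp: c_low omega one_to_four Tr_gamma distrib_right)
    moreover have "(\<Sum>j\<in>T - {1..4}. c j i) = (\<Sum>j\<in>T - {1..4}. if i = j then 1 else 0)"
      using i T(1) by (intro sum.cong) (auto simp: c_high)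
    ultimately show False using split[of i] i fin by simp
  qed
  then have T4: "T \<subseteq> {1..4}" by blast
  have "1 \<notin> T" "2 \<notin> T" "3 \<notin> T" "4 \<notin> T"
    using sum0[of 1] sum0[of 2] sum0[of 3] sum0[of 4]
    unfolding sum_low[OF T4] by (auto simp: c_low Tr_omega split: if_splits)
  then have "T = {}" using T4 unfolding one_to_four by auto
  with T(2) show False by simp
qed

lemma io_cost_eq: "io_cost l UNIV 0 \<beta> g + 2 ^ l = (2 ^ l - 1) * l"
proof -
  have "\<beta> i \<noteq> 0" if "i \<in> {1..l}" for i
    using basis[unfolded B_indep_iff[OF finite_atLeastAtMost], rule_format, of "{i}"] that by simp
  then show ?thesis
    using io_cost_add_card_zeros[of 0 g \<beta>] zeros_node_empty[OF node_independent] sum_card_zeros_eq by simp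
qed

section \<open>Repair bandwidth of the construction\<close>

text \<open>The hypothesis says that columns \<open>i\<close> and \<open>k\<close> agree; by
  \<open>Tr_entries\<close> they are then zero. For columns 3 and 4 this means
  \<open>(x, y, x+y, y) = (x, y, x, x+y)\<close>, hence \<open>x = y = 0\<close>.\<close>

lemma zeros_pair_aux:
  assumes ij: "i \<in> {1..4}" "k \<in> {1..4}" "i < k" and \<alpha>: "\<alpha> \<in> zeros g (\<beta> i + \<beta> k)"
  shows "\<alpha> \<in> zeros g (\<beta> i)"
proof -
  have "sum \<beta> {i, k} = \<beta> i + \<beta> k" using ij(3) by simp
  then have *: "Tr l (poly (g j) \<alpha> * \<beta> i) = Tr l (poly (g j) \<alpha> * \<beta> k)" if "j \<in> {1..4}" for j
  proof -
    have "Tr l (poly (g j) \<alpha> * (\<beta> i + \<beta> k)) = 0"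
      using zeros_low[of "{i, k}"] \<alpha> ij that by auto
    then show ?thesis
      unfolding distrib_left Tr_add
      by (cases "Tr l (poly (g j) \<alpha> * \<beta> i)"; cases "Tr l (poly (g j) \<alpha> * \<beta> k)") simp_all
  qed
  note E = *[of 1] *[of 2] *[of 3] *[of 4]
  consider "i = 1" "k = 2" | "i = 1" "k = 3" | "i = 1" "k = 4" | "i = 2" "k = 3" | "i = 2" "k = 4" | "i = 3" "k = 4"
    using ij unfolding one_to_four by auto
  then have "Tr l (poly (g 1) \<alpha> * \<beta> i) = 0 \<and> Tr l (poly (g 2) \<alpha> * \<beta> i) = 0
      \<and> Tr l (poly (g 3) \<alpha> * \<beta> i) = 0 \<and> Tr l (poly (g 4) \<alpha> * \<beta> i) = 0"
  proof cases
    case 6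
    then show ?thesis
      using E Tr_entries[of \<alpha>]
      by (cases "Tr l (poly (g 1) \<alpha> * \<beta> 3)"; cases "Tr l (poly (g 2) \<alpha> * \<beta> 3)") simp_all
  qed (use E Tr_entries[of \<alpha>] in simp_all)
  then show ?thesis
    using zeros_low1[OF ij(1)] one_to_four by simp
qed

lemma zeros_pair:
  assumes "i \<in> {1..4}" "k \<in> {1..4}" "i \<noteq> k" "\<alpha> \<in> zeros g (\<beta> i + \<beta> k)"
  shows "\<alpha> \<in> zeros g (\<beta> i)"
proof (cases "i < k")
  case False
  then have "\<alpha> \<in> zeros g (\<beta> k)"
    using assms zeros_pair_aux[of k i \<alpha>] by (simp add: add.commute)
  from zeros_add[OF assms(4) this] show ?thesis by (simp add: add.assoc)
qed (use assms zeros_pair_aux in blast)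

definition exceptional :: "'a set"
  where "exceptional = (\<Union>u\<in>{u. u \<subseteq> {1..4} \<and> 3 \<le> card u}. zeros g (sum \<beta> u))"

text \<open>Only sets inside \<open>{1..4}\<close> need checking: if a set of columns contains some
  \<open>j \<ge> 5\<close>, then row \<open>j\<close> is 1 in column \<open>j\<close> and 0
  elsewhere, so the columns do not sum to zero.\<close>

lemma rank_lower_bound:
  assumes D: "D \<subseteq> {1..l}" and "\<And>u. u \<subseteq> D \<Longrightarrow> u \<subseteq> {1..4} \<Longrightarrow> u \<noteq> {} \<Longrightarrow> \<alpha> \<notin> zeros g (sum \<beta> u)"
  shows "card D \<le> vec_space.rank l (W l \<beta> g \<alpha>)"
proof -
  define S where "S = {i. Suc i \<in> D}"
  have Suc_S: "Suc ` S = D"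
  proof
    show "D \<subseteq> Suc ` S"
    proof
      fix x assume "x \<in> D"
      moreover from this have "x = Suc (x - 1)" using D by auto
      ultimately show "x \<in> Suc ` S" by (intro image_eqI[of _ _ "x - 1"]) (simp_all add: S_def)
    qed
  qed (auto simp: S_def)
  have "card S \<le> vec_space.rank l (W l \<beta> g \<alpha>)"
  proof (rule card_le_rank_bit)
    show "W l \<beta> g \<alpha> \<in> carrier_mat l l" by (simp add: W_def)
    show "S \<subseteq> {..<l}" using D by (auto simp: S_def)
    fix T assume T: "T \<subseteq> S" "T \<noteq> {}"
    define u where "u = Suc ` T"
    have u: "u \<subseteq> D" "u \<noteq> {}" using T Suc_S by (auto simp: u_def)
    have entry: "(\<Sum>s\<in>T. W l \<beta> g \<alpha> $$ (i, s)) = Tr l (poly (g (Suc i)) \<alpha> * sum \<beta> u)" if "i < l" for i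
      using that T(1) \<open>S \<subseteq> {..<l}\<close>
      by (auto simp: W_def u_def sum.reindex sum_distrib_left Tr_sum intro!: sum.cong)
    have "\<exists>j\<in>{1..l}. Tr l (poly (g j) \<alpha> * sum \<beta> u) \<noteq> 0"
    proof (cases "u \<subseteq> {1..4}")
      case True
      then show ?thesis using assms(2)[OF u(1) True u(2)] by (auto simp: zeros_def)
    next
      case False
      then obtain j where j: "j \<in> u" "j \<notin> {1..4}" by blast
      then have jl: "j \<in> {1..l}" using u(1) D by blast
      have "Tr l (poly (g j) \<alpha> * sum \<beta> u) = (\<Sum>i\<in>u. Tr l (\<gamma> j * \<beta> i))"
        using j jl by (simp add: g_high sum_distrib_left Tr_sum)
      also have "\<dots> = (\<Sum>i\<in>u. if i = j then 1 else 0)"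
        using u(1) D jl by (intro sum.cong) (auto simp: Tr_gamma)
      also have "\<dots> = 1"
        using j(1) finite_subset[OF subset_trans[OF u(1) D]] by simp
      finally show ?thesis using jl by auto
    qed
    then obtain j where j: "j \<in> {1..l}" "Tr l (poly (g j) \<alpha> * sum \<beta> u) \<noteq> 0" by blast
    moreover have "j - 1 < l" "Suc (j - 1) = j" using j(1) by auto
    ultimately show "\<exists>i<l. (\<Sum>s\<in>T. W l \<beta> g \<alpha> $$ (i, s)) \<noteq> 0"
      using entry[of "j - 1"] by metis
  qed
  then show ?thesis
    using Suc_S by (metis card_image inj_Suc inj_on_subset subset_UNIV)
qed

text \<open>Two distinct relations among the nonzero columns, each of weight at least 3, would add up to
  one of weight at most 2; so deleting one column always suffices.\<close>

lemma rank_W_ge: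
  "l \<le> vec_space.rank l (W l \<beta> g \<alpha>) + card {i\<in>{1..l}. \<alpha> \<in> zeros g (\<beta> i)} + (if \<alpha> \<in> exceptional then 1 else 0)"
proof -
  define D where "D = {i\<in>{1..l}. \<alpha> \<notin> zeros g (\<beta> i)}"
  define R where "R u \<longleftrightarrow> u \<subseteq> D \<and> u \<subseteq> {1..4} \<and> u \<noteq> {} \<and> \<alpha> \<in> zeros g (sum \<beta> u)" for u
  have D: "D \<subseteq> {1..l}" "finite D" by (auto simp: D_def)
  have "card (D \<union> {i\<in>{1..l}. \<alpha> \<in> zeros g (\<beta> i)}) = card D + card {i\<in>{1..l}. \<alpha> \<in> zeros g (\<beta> i)}"
    by (rule card_Un_disjoint) (auto simp: D_def)
  moreover have "D \<union> {i\<in>{1..l}. \<alpha> \<in> zeros g (\<beta> i)} = {1..l}" by (auto simp: D_def)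
  ultimately have card_D: "card D + card {i\<in>{1..l}. \<alpha> \<in> zeros g (\<beta> i)} = l" by simp
  have R_card: "3 \<le> card u" if "R u" for u
  proof (rule ccontr)
    assume "\<not> 3 \<le> card u"
    moreover have "card u \<noteq> 0"
      using that finite_subset[of u D] D(2) by (auto simp: R_def)
    ultimately consider "card u = 1" | "card u = 2" by linarith
    then show False
    proof cases
      case 1
      then obtain i where "u = {i}" by (rule card_1_singletonE)
      then show ?thesis using that by (auto simp: R_def D_def)
    next
      case 2
      then obtain i k where "u = {i, k}" "i \<noteq> k" by (auto simp: card_2_iff)
      then show ?thesis using that zeros_pair[of i k \<alpha>] by (auto simp: R_def D_def)
    qed
  qed
  show ?thesis
  proof (cases "\<exists>u. R u")
    case False
    then have "card D \<le> vec_space.rank l (W l \<beta> g \<alpha>)"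
      by (intro rank_lower_bound D) (auto simp: R_def)
    then show ?thesis using card_D by simp
  next
    case True
    then obtain u where u: "R u" by blast
    then have "\<alpha> \<in> exceptional" using R_card[OF u] by (auto simp: exceptional_def R_def)
    obtain i where i: "i \<in> u" using u by (auto simp: R_def)
    have "card (D - {i}) \<le> vec_space.rank l (W l \<beta> g \<alpha>)"
    proof (rule rank_lower_bound)
      fix v assume v: "v \<subseteq> D - {i}" "v \<subseteq> {1..4}" "v \<noteq> {}"
      show "\<alpha> \<notin> zeros g (sum \<beta> v)"
      proof
        assume "\<alpha> \<in> zeros g (sum \<beta> v)"
        then have "R v" using v by (auto simp: R_def)
        have fin: "finite u" "finite v"
          using u v(2) finite_subset[of _ "{1..4::nat}"] by (auto simp: R_def)
        have "\<alpha> \<in> zeros g (sum \<beta> (sym_diff u v))"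
          using zeros_add[of \<alpha> g "sum \<beta> u" "sum \<beta> v"] \<open>R v\<close> u fin by (simp add: sum_symdiff R_def)
        \<comment> \<open>\<open>i\<close> lies in \<open>u\<close> but not in \<open>v\<close>, so
          the symmetric difference is nonempty.\<close>
        then have "R (sym_diff u v)"
          using u \<open>R v\<close> i v(1) by (auto simp: R_def)
        moreover have "card (sym_diff u v) \<le> 2"
        proof -
          have "card (u \<union> v) \<le> card {1..4::nat}"
            using u v(2) by (intro card_mono) (auto simp: R_def)
          moreover have "card u + card v = card (u \<union> v) + card (u \<inter> v)"
            by (rule card_Un_Int[OF fin])
          moreover have "card (sym_diff u v) = card (u \<union> v) - card (u \<inter> v)"
            using fin by (subst card_Diff_subset[symmetric]) (auto intro!: arg_cong[where f = card])
          moreover have "card (u \<inter> v) \<le> card (u \<union> v)"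
            using fin by (intro card_mono) auto
          ultimately show ?thesis using R_card[OF u] R_card[OF \<open>R v\<close>] by simp
        qed
        ultimately show False using R_card by fastforce
      qed
    qed (use D in auto)
    moreover have "card D \<le> card (D - {i}) + 1"
      using card_Suc_Diff1[OF D(2), of i] i u by (auto simp: R_def)
    ultimately show ?thesis using card_D \<open>\<alpha> \<in> exceptional\<close> by simp
  qed
qed

lemma repair_bandwidth_ge:
  "(2 ^ l - 1) * l \<le> repair_bandwidth l UNIV 0 \<beta> g + 2 ^ l + card exceptional"
proof -
  have nonzero: "\<beta> i \<noteq> 0" if "i \<in> {1..l}" for i
    using basis[unfolded B_indep_iff[OF finite_atLeastAtMost], rule_format, of "{i}"] that by simp
  have "(2 ^ l - 1) * l = (\<Sum>\<alpha>\<in>(UNIV :: 'a set) - {0}. l)"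
    by (simp add: card_field)
  also have "\<dots> \<le> (\<Sum>\<alpha>\<in>UNIV - {0}. vec_space.rank l (W l \<beta> g \<alpha>)
      + card {i\<in>{1..l}. \<alpha> \<in> zeros g (\<beta> i)} + (if \<alpha> \<in> exceptional then 1 else 0))"
    by (intro sum_mono rank_W_ge)
  also have "\<dots> = repair_bandwidth l UNIV 0 \<beta> g + 2 ^ l + (\<Sum>\<alpha>\<in>UNIV - {0}. if \<alpha> \<in> exceptional then 1 else 0)"
    using sum_card_zeros[of 0 g \<beta>] zeros_node_empty[OF node_independent] nonzero sum_card_zeros_eq
    by (simp add: sum.distrib repair_bandwidth_def)
  also have "(\<Sum>\<alpha>\<in>UNIV - {0}. if \<alpha> \<in> exceptional then 1 else 0) \<le> card exceptional"
    by (subst sum.inter_restrict[symmetric]) (auto intro: card_mono)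
  finally show ?thesis by simp
qed

lemma repair_bandwidth_le: "repair_bandwidth l UNIV 0 \<beta> g \<le> io_cost l UNIV 0 \<beta> g"
  unfolding repair_bandwidth_def io_cost_def
  by (intro sum_mono rank_le_nz[where c = l]) (simp add: W_def)

section \<open>Counting the exceptional nodes\<close>

lemma card_zeros_generic:
  assumes u: "u \<subseteq> {1..4}" "2 \<le> card u" and neq: "sum \<beta> u * (\<theta> + 1)\<^sup>2 \<noteq> (slope 1 + \<theta> * slope 3)\<^sup>2"
  shows "16 * card (zeros g (sum \<beta> u)) = 2 ^ l"
proof -
  have fin: "finite u" using u(1) finite_subset by blast
  have nonzero: "sum \<beta> u \<noteq> 0" using u by (intro beta_sum) auto
  \<comment> \<open>With this \<open>rows_independent\<close> applies, and four independent
    conditions leave \<open>n/16\<close> nodes.\<close>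
  have other: "sum \<beta> u \<noteq> \<beta> i" if "i \<in> {1..4}" for i
  proof
    assume "sum \<beta> u = \<beta> i"
    then have "sum \<beta> (sym_diff u {i}) = 0"
      using sum_symdiff[of u "{i}" \<beta>] fin by simp
    moreover have "sym_diff u {i} \<noteq> {}" using u(2) card_mono[of "{i}" u] by auto
    moreover have "sym_diff u {i} \<subseteq> {1..4}" using u(1) that by blast
    ultimately show False using beta_sum by blast
  qed
  show ?thesis
    using card_rows[OF subset_refl rows_independent[OF nonzero other neq]] zeros_low[OF u(1)] by simp
qed

text \<open>For this \<open>b\<close> the coefficients of rows 2 and 3 cancel, so these rows add up
  to a constant. As \<open>\<omega> 2 + \<omega> 3 = \<gamma> 1 + \<gamma> 2 + \<gamma> 3 + \<gamma>
  4\<close>, the constant is the parity of \<open>card u\<close>, which is odd.\<close>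

lemma zeros_odd_empty:
  assumes u: "u \<subseteq> {1..4}" "card u = 3" and eq: "sum \<beta> u * (\<theta> + 1)\<^sup>2 = (slope 1 + \<theta> * slope 3)\<^sup>2"
  shows "zeros g (sum \<beta> u) = {}"
proof -
  define b where "b = sum \<beta> u"
  have "(\<theta> + 1)\<^sup>2 * (row_coeff 2 b + row_coeff 3 b)
      = b * ((\<theta> + 1)\<^sup>2 * ((\<eta> 2 * slope 2 + \<eta> 3 * slope 3)\<^sup>2) + b * (\<theta> + 1)\<^sup>2 * (\<eta> 2 + \<eta> 3)\<^sup>2)"
    using sum_row_coeff[of "{2, 3}" b] by (simp add: algebra_simps)
  also have "\<dots> = b * (((\<theta> + 1) * (\<eta> 2 * slope 2 + \<eta> 3 * slope 3)) + (slope 1 + \<theta> * slope 3) * (\<eta> 2 + \<eta> 3))\<^sup>2"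
    unfolding square_add[of "_ * _" "_ * _"] power_mult_distrib b_def eq ..
  also have "(\<theta> + 1) * (\<eta> 2 * slope 2 + \<eta> 3 * slope 3) = (slope 1 + \<theta> * slope 3) * (\<eta> 2 + \<eta> 3)"
    by (simp add: eta slope_def norm_simps)
  finally have rows: "row_coeff 2 b + row_coeff 3 b = 0"
    using theta_not_in_F4 by simp
  have "Tr l (\<omega> 2 * b) + Tr l (\<omega> 3 * b) = (\<Sum>i\<in>u. Tr l (\<omega> 2 * \<beta> i) + Tr l (\<omega> 3 * \<beta> i))"
    unfolding b_def sum_distrib_left Tr_sum sum.distrib ..
  also have "\<dots> = (\<Sum>i\<in>u. 1)"
    using u(1) by (intro sum.cong) (auto simp: Tr_omega one_to_four)
  also have "\<dots> = 1" using u(2) by simp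
  finally have omega: "Tr l (\<omega> 2 * b) + Tr l (\<omega> 3 * b) = 1" .
  have "Tr l (poly (g 2) \<alpha> * b) + Tr l (poly (g 3) \<alpha> * b) = 1" for \<alpha>
  proof -
    have "Tr l (row_coeff 2 b * \<alpha>\<^sup>2) + Tr l (row_coeff 3 b * \<alpha>\<^sup>2) = Tr l ((row_coeff 2 b + row_coeff 3 b) * \<alpha>\<^sup>2)"
      by (simp only: distrib_right Tr_add)
    also have "\<dots> = 0" by (simp only: rows mult_zero_left Tr_0)
    finally show ?thesis
      using omega by (cases "Tr l (\<omega> 2 * b)"; cases "Tr l (\<omega> 3 * b)";
        cases "Tr l (row_coeff 2 b * \<alpha>\<^sup>2)"; cases "Tr l (row_coeff 3 b * \<alpha>\<^sup>2)") (simp_all add: Tr_row)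
  qed
  moreover have "Tr l (poly (g j) \<alpha> * b) = 0" if "\<alpha> \<in> zeros g b" "j \<in> {1..4}" for \<alpha> j
    using that l_ge by (simp add: zeros_def)
  ultimately have "\<alpha> \<notin> zeros g b" for \<alpha>
    using one_to_four by (metis add_0 insertCI zero_neq_one)
  then show ?thesis by (auto simp: b_def)
qed

lemma card_zeros_odd:
  assumes "u \<subseteq> {1..4}" "card u = 3"
  shows "16 * card (zeros g (sum \<beta> u)) \<le> 2 ^ l"
  using card_zeros_generic[of u] zeros_odd_empty[OF assms] assms by fastforce

lemma exceptional_subset:
  "exceptional \<subseteq> zeros g (sum \<beta> {1, 2, 3}) \<union> zeros g (sum \<beta> {1, 2, 4}) \<union> zeros g (sum \<beta> {1, 3, 4})
    \<union> zeros g (sum \<beta> {2, 3, 4}) \<union> zeros g (sum \<beta> {1..4})"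
proof -
  have cases: "u \<in> {{1, 2, 3}, {1, 2, 4}, {1, 3, 4}, {2, 3, 4}, {1, 2, 3, 4}}"
    if "u \<subseteq> {1, 2, 3, 4}" "3 \<le> card u" for u :: "nat set"
  proof -
    have u: "u \<subseteq> {1..4}" using that(1) one_to_four by simp
    have "3 \<le> sum (\<lambda>_. 1::nat) u" using that(2) by simp
    then consider "1 \<in> u" "2 \<in> u" "3 \<in> u" | "1 \<in> u" "2 \<in> u" "4 \<in> u"
      | "1 \<in> u" "3 \<in> u" "4 \<in> u" | "2 \<in> u" "3 \<in> u" "4 \<in> u"
      unfolding sum_low[OF u] by (auto split: if_splits)
    then show ?thesis
    proof cases
      case 1
      then show ?thesis using that(1) by (cases "4 \<in> u") auto
    next
      case 2
      then show ?thesis using that(1) by (cases "3 \<in> u") auto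
    next
      case 3
      then show ?thesis using that(1) by (cases "2 \<in> u") auto
    next
      case 4
      then show ?thesis using that(1) by (cases "1 \<in> u") auto
    qed
  qed
  show ?thesis
    unfolding exceptional_def one_to_four
  proof (rule UN_least)
    fix u :: "nat set" assume "u \<in> {u. u \<subseteq> {1, 2, 3, 4} \<and> 3 \<le> card u}"
    then have "u \<in> {{1, 2, 3}, {1, 2, 4}, {1, 3, 4}, {2, 3, 4}, {1, 2, 3, 4}}"
      by (intro cases) simp_all
    then show "zeros g (sum \<beta> u) \<subseteq> zeros g (sum \<beta> {1, 2, 3}) \<union> zeros g (sum \<beta> {1, 2, 4})
      \<union> zeros g (sum \<beta> {1, 3, 4}) \<union> zeros g (sum \<beta> {2, 3, 4}) \<union> zeros g (sum \<beta> {1, 2, 3, 4})"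
      by (elim insertE emptyE; hypsubst; blast)
  qed
qed

text \<open>The square root of the sum of all four is \<open>\<theta>\<^sup>2 + 1\<close>; taking
  roots in the hypothesis leaves a cubic in \<theta> with the factor \<theta>.\<close>

lemma theta_quadratic:
  assumes "sum \<beta> {1..4} * (\<theta> + 1)\<^sup>2 = (slope 1 + \<theta> * slope 3)\<^sup>2"
  shows "\<theta>\<^sup>2 = \<zeta> * \<theta> + \<zeta>"
proof -
  have "sum \<beta> {1..4} = (\<theta>\<^sup>2 + 1)\<^sup>2"
    unfolding one_to_four by (simp add: beta flip: square_add) (simp add: square_inj norm_simps)
  then have "((\<theta>\<^sup>2 + 1) * (\<theta> + 1))\<^sup>2 = (slope 1 + \<theta> * slope 3)\<^sup>2"
    using assms by (simp add: power_mult_distrib)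
  then have "(\<theta>\<^sup>2 + 1) * (\<theta> + 1) + (slope 1 + \<theta> * slope 3) = 0"
    by (simp add: square_inj)
  also have "(\<theta>\<^sup>2 + 1) * (\<theta> + 1) + (slope 1 + \<theta> * slope 3) = \<theta> * (\<theta>\<^sup>2 + (\<zeta> * \<theta> + \<zeta>))"
    by (simp add: slope_def norm_simps)
  finally show ?thesis using theta_not_in_F4 by simp
qed

lemma theta_sq:
  assumes "\<theta>\<^sup>2 = \<zeta> * \<theta> + \<zeta>"
  shows "\<theta> * \<theta> = \<zeta> * \<theta> + \<zeta>" "\<theta> * (\<theta> * x) = \<zeta> * (\<theta> * x) + \<zeta> * x"
proof -
  show tt: "\<theta> * \<theta> = \<zeta> * \<theta> + \<zeta>" using assms by (simp add: power2_eq_square)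
  show "\<theta> * (\<theta> * x) = \<zeta> * (\<theta> * x) + \<zeta> * x"
    unfolding mult.assoc[symmetric] tt distrib_right ..
qed

text \<open>The relation is quadratic over the field of four elements, so
  \<open>\<theta> ^ 16 = \<theta>\<close>; a primitive \<theta> then leaves at most 15 nonzero
  elements.\<close>

lemma l_eq_4:
  assumes "\<theta>\<^sup>2 = \<zeta> * \<theta> + \<zeta>"
  shows "l = 4"
proof -
  have "(\<theta>\<^sup>2)\<^sup>2 = \<theta> + \<zeta>"
    by (simp add: norm_simps theta_sq[OF assms])
  then have "((\<theta>\<^sup>2)\<^sup>2)\<^sup>2 = \<theta>\<^sup>2 + \<zeta>\<^sup>2" by (simp add: square_add)
  then have "(((\<theta>\<^sup>2)\<^sup>2)\<^sup>2)\<^sup>2 = (\<theta>\<^sup>2)\<^sup>2 + (\<zeta>\<^sup>2)\<^sup>2" by (simp add: square_add)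
  also have "\<dots> = \<theta>" using \<open>(\<theta>\<^sup>2)\<^sup>2 = \<theta> + \<zeta>\<close> by (simp add: norm_simps)
  finally have "\<theta> ^ 16 = \<theta>" by (simp flip: power_mult)
  then have "\<theta> * \<theta> ^ 15 = \<theta> * 1" by (simp flip: power_Suc)
  then have one: "\<theta> ^ 15 = 1" using theta_not_in_F4 by (subst (asm) mult_cancel_left) simp
  have "\<theta> ^ i = \<theta> ^ (i mod 15)" for i :: nat
  proof -
    have "\<theta> ^ (15 * (i div 15) + i mod 15) = \<theta> ^ (i mod 15)"
      unfolding power_add power_mult one by simp
    then show ?thesis by simp
  qed
  then have "range (\<lambda>i::nat. \<theta> ^ i) \<subseteq> (\<lambda>i. \<theta> ^ i) ` {..<15}"
    by (metis (no_types, lifting) image_subsetI lessThan_iff mod_less_divisor rev_image_eqI zero_less_numeral)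
  then have "card (UNIV - {0 :: 'a}) \<le> card ((\<lambda>i. \<theta> ^ i) ` {..<15::nat})"
    using primitive unfolding primitive_element_def by (intro card_mono) auto
  also have "\<dots> \<le> 15" using card_image_le[of "{..<15::nat}" "\<lambda>i. \<theta> ^ i"] by simp
  finally have "2 ^ l \<le> (2::nat) ^ 4" by (simp add: card_field)
  then have "l \<le> 4" by (subst (asm) power_increasing_iff) auto
  then show ?thesis using l_ge by simp
qed

text \<open>Under the quadratic relation two rows at the missing basis element are sums of rows at
  the triple sum \<open>b\<close>. A zero for \<open>b\<close> is thus a zero for the missing
  element, hence for the total.\<close>

lemma zeros_triple_subset:
  assumes "\<theta>\<^sup>2 = \<zeta> * \<theta> + \<zeta>"
  shows "zeros g (sum \<beta> {2, 3, 4}) \<subseteq> zeros g (sum \<beta> {1..4})"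
    and "zeros g (sum \<beta> {1, 3, 4}) \<subseteq> zeros g (sum \<beta> {1..4})"
proof -
  note tt = theta_sq[OF assms]
  have bit: "Tr l (poly (g i) \<alpha> * b) + Tr l (poly (g j) \<alpha> * b) =
      Tr l ((row_coeff i b + row_coeff j b) * \<alpha>\<^sup>2) + Tr l ((\<omega> i + \<omega> j) * b)"
    if "i \<in> {1..4}" "j \<in> {1..4}" for i j b \<alpha>
    unfolding Tr_row[OF that(1)] Tr_row[OF that(2)] distrib_right Tr_add by (simp only: ac_simps)
  show "zeros g (sum \<beta> {2, 3, 4}) \<subseteq> zeros g (sum \<beta> {1..4})"
  proof
    fix \<alpha> assume \<alpha>: "\<alpha> \<in> zeros g (sum \<beta> {2, 3, 4})"
    define b where "b = sum \<beta> {2, 3, 4}"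
    have z: "Tr l (poly (g j) \<alpha> * b) = 0" if "j \<in> {1..4}" for j
      using \<alpha> zeros_low[of "{2, 3, 4}"] that by (auto simp: b_def)
    have rows: "row_coeff 3 (\<beta> 1) = row_coeff 2 b + row_coeff 3 b" "row_coeff 4 (\<beta> 1) = row_coeff 1 b + row_coeff 4 b"
      by (simp_all add: row_coeff_def lam eta beta b_def norm_simps tt)
    have "Tr l (poly (g 3) \<alpha> * \<beta> 1) = Tr l (poly (g 2) \<alpha> * b) + Tr l (poly (g 3) \<alpha> * b)"
      using Tr_row[of 3 \<alpha> "\<beta> 1"] bit[of 2 3 \<alpha> b] by (simp add: rows b_def distrib_left distrib_right Tr_omega)
    moreover have "Tr l (poly (g 4) \<alpha> * \<beta> 1) = Tr l (poly (g 1) \<alpha> * b) + Tr l (poly (g 4) \<alpha> * b)"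
      using Tr_row[of 4 \<alpha> "\<beta> 1"] bit[of 1 4 \<alpha> b] by (simp add: rows b_def distrib_left distrib_right Tr_omega)
    ultimately have "\<alpha> \<in> zeros g (\<beta> 1)"
      using z by (simp add: zeros_rows)
    from zeros_add[OF this \<alpha>] show "\<alpha> \<in> zeros g (sum \<beta> {1..4})"
      by (simp add: one_to_four)
  qed
  show "zeros g (sum \<beta> {1, 3, 4}) \<subseteq> zeros g (sum \<beta> {1..4})"
  proof
    fix \<alpha> assume \<alpha>: "\<alpha> \<in> zeros g (sum \<beta> {1, 3, 4})"
    define b where "b = sum \<beta> {1, 3, 4}"
    have z: "Tr l (poly (g j) \<alpha> * b) = 0" if "j \<in> {1..4}" for j
      using \<alpha> zeros_low[of "{1, 3, 4}"] that by (auto simp: b_def)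
    have rows: "row_coeff 1 (\<beta> 2) = row_coeff 1 b + row_coeff 4 b" "row_coeff 2 (\<beta> 2) = row_coeff 2 b + row_coeff 3 b"
      by (simp_all add: row_coeff_def lam eta beta b_def norm_simps tt)
    have "Tr l (poly (g 1) \<alpha> * \<beta> 2) = Tr l (poly (g 1) \<alpha> * b) + Tr l (poly (g 4) \<alpha> * b)"
      using Tr_row[of 1 \<alpha> "\<beta> 2"] bit[of 1 4 \<alpha> b] by (simp add: rows b_def distrib_left distrib_right Tr_omega)
    moreover have "Tr l (poly (g 2) \<alpha> * \<beta> 2) = Tr l (poly (g 2) \<alpha> * b) + Tr l (poly (g 3) \<alpha> * b)"
      using Tr_row[of 2 \<alpha> "\<beta> 2"] bit[of 2 3 \<alpha> b] by (simp add: rows b_def distrib_left distrib_right Tr_omega)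
    ultimately have "\<alpha> \<in> zeros g (\<beta> 2)"
      using z by (simp add: zeros_rows)
    from zeros_add[OF this \<alpha>] show "\<alpha> \<in> zeros g (sum \<beta> {1..4})"
      by (simp add: one_to_four add.left_commute)
  qed
qed

text \<open>Generically there are five sets of at most \<open>n/16\<close> nodes. In the remaining
  case \<open>n = 16\<close> and two triples are absorbed by the full sum, so at most
  \<open>1 + 1 + 4 = 6\<close> nodes are left, which is exactly \<open>7n/16 - 1\<close>.\<close>

lemma card_exceptional: "16 * card exceptional + 16 \<le> 7 * 2 ^ l"
proof -
  have four: "16 \<le> (2::nat) ^ l" using l_ge power_increasing[of 4 l "2::nat"] by simp
  have sub: "{1, 2, 3} \<subseteq> {1..4::nat}" "{1, 2, 4} \<subseteq> {1..4::nat}" "{1, 3, 4} \<subseteq> {1..4::nat}" "{2, 3, 4} \<subseteq> {1..4::nat}"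
    by auto
  have triple: "16 * card (zeros g (sum \<beta> {1, 2, 3})) \<le> 2 ^ l" "16 * card (zeros g (sum \<beta> {1, 2, 4})) \<le> 2 ^ l"
    "16 * card (zeros g (sum \<beta> {1, 3, 4})) \<le> 2 ^ l" "16 * card (zeros g (sum \<beta> {2, 3, 4})) \<le> 2 ^ l"
    by (intro card_zeros_odd sub; simp)+
  have union: "card (A \<union> B) \<le> p + q" if "card A \<le> p" "card B \<le> q" for A B :: "'a set" and p q
    using card_Un_le[of A B] that by linarith
  show ?thesis
  proof (cases "sum \<beta> {1..4} * (\<theta> + 1)\<^sup>2 = (slope 1 + \<theta> * slope 3)\<^sup>2")
    case False
    then have all: "16 * card (zeros g (sum \<beta> {1..4})) = 2 ^ l"
      by (intro card_zeros_generic) auto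
    have "card exceptional \<le> card (zeros g (sum \<beta> {1, 2, 3})) + card (zeros g (sum \<beta> {1, 2, 4}))
      + card (zeros g (sum \<beta> {1, 3, 4})) + card (zeros g (sum \<beta> {2, 3, 4})) + card (zeros g (sum \<beta> {1..4}))"
      by (rule order.trans[OF card_mono[OF finite exceptional_subset]]) (intro union order.refl)
    then show ?thesis using all triple four by linarith
  next
    case True
    then have quadratic: "\<theta>\<^sup>2 = \<zeta> * \<theta> + \<zeta>" by (rule theta_quadratic)
    have l: "l = 4" by (rule l_eq_4[OF quadratic])
    have nz: "sum \<beta> {1..4} \<noteq> 0" by (rule beta_sum) auto
    have "sum \<beta> {1..4} = \<beta> 1 + sum \<beta> {2, 3, 4}" by (simp add: one_to_four)
    then have "sum \<beta> {1..4} \<noteq> \<beta> 1" using beta_sum[OF sub(4)] by (metis add_cancel_left_right insert_not_empty)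
    \<comment> \<open>All four rows are no longer independent here, but rows 1 and 2 are, because
      the full sum differs from \<open>\<beta> 1\<close>.\<close>
    with nz have "4 * card {\<alpha>. \<forall>j\<in>{1, 2}. Tr l (poly (g j) \<alpha> * sum \<beta> {1..4}) = 0} = 2 ^ l"
      using card_rows[of "{1, 2}" "sum \<beta> {1..4}", OF _ rows_12_independent] by simp
    moreover have "card (zeros g (sum \<beta> {1..4})) \<le> card {\<alpha>. \<forall>j\<in>{1, 2}. Tr l (poly (g j) \<alpha> * sum \<beta> {1..4}) = 0}"
      by (intro card_mono) (auto simp: zeros_low)
    ultimately have all: "4 * card (zeros g (sum \<beta> {1..4})) \<le> 2 ^ l" by linarith
    have "exceptional \<subseteq> zeros g (sum \<beta> {1, 2, 3}) \<union> zeros g (sum \<beta> {1, 2, 4}) \<union> zeros g (sum \<beta> {1..4})"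
      using exceptional_subset zeros_triple_subset[OF quadratic] by blast
    then have "card exceptional \<le> card (zeros g (sum \<beta> {1, 2, 3}) \<union> zeros g (sum \<beta> {1, 2, 4}) \<union> zeros g (sum \<beta> {1..4}))"
      by (intro card_mono) auto
    also have "\<dots> \<le> card (zeros g (sum \<beta> {1, 2, 3})) + card (zeros g (sum \<beta> {1, 2, 4})) + card (zeros g (sum \<beta> {1..4}))"
      by (intro union order.refl)
    finally have "card exceptional \<le> card (zeros g (sum \<beta> {1, 2, 3})) + card (zeros g (sum \<beta> {1, 2, 4})) + card (zeros g (sum \<beta> {1..4}))" .
    then show ?thesis using all triple l by simp
  qed
qed

end

theorem proposition20:
  fixes l n :: nat
    and \<zeta> \<theta> :: "'a::finite_field"
    and \<beta> \<gamma> \<eta> \<omega> lam :: "nat \<Rightarrow> 'a"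
    and g :: "nat \<Rightarrow> 'a poly"
  assumes "l \<ge> 4" and "even l" and "n = 2 ^ l" and "CARD('a) = n"
    and "\<zeta>\<^sup>2 + \<zeta> + 1 = 0"
    and "primitive_element \<theta>"
    and "\<beta> 1 = (\<theta>\<^sup>2 + (\<zeta> + 1) * \<theta> + 1)\<^sup>2"
    and "\<beta> 2 = (\<zeta> * \<theta>)\<^sup>2"
    and "\<beta> 3 = 1"
    and "\<beta> 4 = (\<theta> + 1)\<^sup>2"
    and "B_indep {1..4} \<beta>"
    and "B_basis l \<beta>"
    and "\<forall>i\<in>{1..l}. \<forall>j\<in>{1..l}. Tr l (\<beta> i * \<gamma> j) = (if i = j then 1 else 0)"
    and "\<eta> 1 = 1" and "\<eta> 2 = \<zeta>" and "\<eta> 3 = \<zeta> * \<theta>" and "\<eta> 4 = \<theta>"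
    and "\<omega> 1 = \<gamma> 3" and "\<omega> 2 = \<gamma> 2 + \<gamma> 4" and "\<omega> 3 = \<gamma> 1 + \<gamma> 3" and "\<omega> 4 = \<gamma> 4"
    and "\<forall>j\<in>{1, 2}. lam j = (\<eta> j)\<^sup>2 * \<beta> 1"
    and "\<forall>j\<in>{3, 4}. lam j = (\<eta> j)\<^sup>2 * \<beta> 2"
    and "\<forall>j\<in>{1..4}. g j = [:\<omega> j, \<eta> j, lam j:]"
    and "\<forall>j\<in>{5..l}. g j = [:\<gamma> j:]"
  shows "linear_repair_scheme l (UNIV :: 'a set) (n - 3) 0 g
    \<and> int (io_cost l UNIV 0 \<beta> g) = (int n - 1) * int l - 2 ^ l
    \<and> (\<forall>(a :: 'a) h \<beta>'. linear_repair_scheme l UNIV (n - 3) a h \<and> B_basis l \<beta>' \<longrightarrow>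
           io_cost l UNIV 0 \<beta> g \<le> io_cost l UNIV a \<beta>' h)
    \<and> (int n - 1) * (int l - 1) - 2 ^ (l - 1) + 2 ^ (l - 4)
         \<le> int (repair_bandwidth l UNIV 0 \<beta> g)
    \<and> int (repair_bandwidth l UNIV 0 \<beta> g) \<le> (int n - 1) * int l - 2 ^ l"
proof -
  have card: "CARD('a) = 2 ^ l" using assms(3,4) by simp
  interpret repair_construction l "TYPE('a)" \<zeta> \<theta> \<beta> \<gamma> \<eta> \<omega> lam g
  proof unfold_locales
    show "B_indep {1..l} \<beta>" using assms(12) unfolding B_basis_def by (rule conjunct1)
    show "Tr l (\<beta> i * \<gamma> j) = (if i = j then 1 else 0)" if "i \<in> {1..l}" "j \<in> {1..l}" for i j
      using assms(13) that by blast
    show "lam j = (\<eta> j)\<^sup>2 * \<beta> 1" if "j \<in> {1, 2}" for j using assms(22) that by blast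
    show "lam j = (\<eta> j)\<^sup>2 * \<beta> 2" if "j \<in> {3, 4}" for j using assms(23) that by blast
    show "g j = [:\<omega> j, \<eta> j, lam j:]" if "j \<in> {1..4}" for j using assms(24) that by blast
    show "g j = [:\<gamma> j:]" if "j \<in> {5..l}" for j using assms(25) that by blast
  qed (fact card assms)+
  have n: "16 \<le> n" using assms(1,3) power_increasing[of 4 l "2::nat"] by simp
  \<comment> \<open>The redundancy is 3, so schemes consist of polynomials of degree at most
    two.\<close>
  have three: "CARD('a) - (n - 3) = 3" using n assms(4) by simp
  have "degree (g j) < 3" if "j \<in> {1..l}" for j
  proof (cases "j \<le> 4")
    case True
    then have "g j = [:\<omega> j, \<eta> j, lam j:]" using that by (intro g_low) simp
    then have "degree (g j) \<le> 2" by (simp add: degree_pCons_le)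
    then show ?thesis by simp
  next
    case False
    then have "g j = [:\<gamma> j:]" using that by (intro g_high) simp
    then show ?thesis by simp
  qed
  then have scheme: "linear_repair_scheme l (UNIV :: 'a set) (n - 3) 0 g"
    using three n assms(4) node_independent by (simp add: linear_repair_scheme_def)
  have "int (io_cost l UNIV 0 \<beta> g + 2 ^ l) = int ((2 ^ l - 1) * l)"
    using io_cost_eq by simp
  then have io: "int (io_cost l UNIV 0 \<beta> g) = (int n - 1) * int l - 2 ^ l"
    using assms(3) by (simp add: of_nat_diff)
  have optimal: "io_cost l UNIV 0 \<beta> g \<le> io_cost l UNIV a \<beta>' h"
    if "linear_repair_scheme l UNIV (n - 3) a h" "B_basis l \<beta>'" for a :: 'a and h \<beta>'
  proof -
    have "(2 ^ l - 1) * l \<le> io_cost l UNIV a \<beta>' h + 2 ^ l"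
      using that unfolding linear_repair_scheme_def B_basis_def three
      by (intro io_cost_lower_bound) auto
    then show ?thesis using io_cost_eq by linarith
  qed
  have upper: "int (repair_bandwidth l UNIV 0 \<beta> g) \<le> (int n - 1) * int l - 2 ^ l"
    using repair_bandwidth_le io by linarith
  define m where "m = (2::nat) ^ (l - 4)"
  have "l = (l - 4) + 4" "l - 1 = (l - 4) + 3" using assms(1) by auto
  then have "2 ^ l = m * 2 ^ 4" "2 ^ (l - 1) = m * 2 ^ 3"
    unfolding m_def by (metis power_add)+
  then have m: "2 ^ l = 16 * m" "2 ^ (l - 1) = 8 * m" by simp_all
  \<comment> \<open>With \<open>n = 16 m\<close> the claimed lower bound is
    \<open>(n - 1) l - n - (7 m - 1)\<close>, so this is the estimate needed.\<close>
  have "card exceptional + 1 \<le> 7 * m" using card_exceptional m by simp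
  moreover have "int ((2 ^ l - 1) * l) \<le> int (repair_bandwidth l UNIV 0 \<beta> g + 2 ^ l + card exceptional)"
    using repair_bandwidth_ge by (simp only: of_nat_le_iff)
  moreover have "int ((2 ^ l - 1) * l) = (int n - 1) * int l"
    using assms(3) by (simp add: of_nat_diff)
  ultimately have "(int n - 1) * int l + 1 \<le> int (repair_bandwidth l UNIV 0 \<beta> g) + int (2 ^ l) + 7 * int m"
    by linarith
  then have "(int n - 1) * int l - int n + 1 - int (2 ^ (l - 1)) + int (2 ^ (l - 4)) \<le> int (repair_bandwidth l UNIV 0 \<beta> g)"
    unfolding assms(3) m m_def[symmetric] by linarith
  then have lower: "(int n - 1) * (int l - 1) - 2 ^ (l - 1) + 2 ^ (l - 4) \<le> int (repair_bandwidth l UNIV 0 \<beta> g)"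
    by (simp add: algebra_simps)
  show ?thesis using scheme io optimal lower upper by blast
qed

end
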